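(* In the sequence-of-problems setting described in the context (hat matrices that are projections onto selected columns, model sizes at most $K$ with $K^2\log p=O(\sqrt n)$, and the accuracy condition on $\hat M$ with constant $\delta>0$), $$\mathrm{Var}\left[\frac{\widehat{\mathrm{Err}}_\alpha}{n}\right]=O\left(\frac{1}{n\alpha^2}\right),$$ that is, there is a constant $C$, not depending on $n$ or $\alpha$, with $\mathrm{Var}[\widehat{\mathrm{Err}}_\alpha/n]\le C/(n\alpha^2)$ for all $n$ and all $0<\alpha<\delta$.
   Context: Setting: $\sigma^2>0$ and $\delta>0$ are fixed. For each $n$ there are: a number of features $p=p_n$, a fixed matrix $X\in\mathbb{R}^{n\times p}$, a fixed mean vector $\mu=\mu(X)\in\mathbb{R}^n$ (not necessarily linear in $X$), a response $y\sim N(\mu,\sigma^2 I_n)$, a collection $\mathcal{M}=\{M_1,\dots,M_{|\mathcal M|}\}\subseteq 2^{\{1,\dots,p\}}$, and a surjective selection map $\hat M:\mathbb{R}^n\to\mathcal{M}$. The sets $U_i=\hat M^{-1}(M_i)$ partition $\mathbb{R}^n$, and each $U_i$ has nonempty interior and boundary of Lebesgue measure $0$. Assumptions (all $O(\cdot)$ constants are independent of $n$): (1) For every $M\in\mathcal{M}$, $H_M=X_M(X_M^TX_M)^{-1}X_M^T$, where $X_M$ is the submatrix of $X$ with columns in $M$ ($H_\emptyset=0$); so $H_M$ is symmetric and $H_M^2=H_M$. The data-dependent hat matrix is $H_{\hat M(y)}=\sum_i H_{M_i}\mathbf 1\{y\in U_i\}$. (2) There is $K=K_n$ such that $\mathrm{rank}(H_M)\le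 |M|\le K$ for every $M\in\mathcal{M}$, and $K^2\log p=O(\sqrt n)$. (3) $\mathbb{E}\big[\big(\|\mu-H_{\hat M(y')}\mu\|_2^2\big)^2\big]=O(n)$ for $y'\sim N(\mu,\tau I_n)$, uniformly over $\sigma^2\le\tau\le(1+\delta)\sigma^2$. Definitions: for $\alpha>0$, $\omega\sim N(0,\alpha\sigma^2I_n)$ is independent of $y$, $y^*=y+\omega$, $y^-=y-\frac1\alpha\omega$, and $$\widehat{\mathrm{Err}}_{\alpha}=\|y^- - H_{\hat M(y^* )}y\|_2^2+2\,\mathrm{tr}(H_{\hat M(y^* )})\sigma^2-\tfrac1\alpha n\sigma^2.$$ *)

theory Defs
  imports "HOL-Probability.Probability" "HOL-Library.Landau_Symbols"
    "Jordan_Normal_Form.Gauss_Jordan_Elimination"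
    "Jordan_Normal_Form.DL_Submatrix"
    "Jordan_Normal_Form.DL_Rank"
begin

(* The dimension n varies, so a point of R^n is an extensional function {..<n} \<rightarrow>\<^sub>E UNIV;
   "vec n x" is the same point as a vector for matrix algebra.  Indices start at 0, so the
   features are {..<p} instead of {1..p}. *)

definition Rn :: "nat \<Rightarrow> (nat \<Rightarrow> real) measure" where
  "Rn n = PiM {..<n} (\<lambda>_. lborel)"

definition top_Rn :: "nat \<Rightarrow> (nat \<Rightarrow> real) topology" where
  "top_Rn n = product_topology (\<lambda>_. euclideanreal) {..<n}"

(* N(m, t I_n); t is the variance, whereas normal_density takes the standard deviation. *)
definition gaussian :: "nat \<Rightarrow> real vec \<Rightarrow> real \<Rightarrow> (nat \<Rightarrow> real) measure" where
  "gaussian n m t = PiM {..<n} (\<lambda>i. density lborel (normal_density (m $ i) (sqrt t)))"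

definition gaussian_rv ::
    "'w measure \<Rightarrow> nat \<Rightarrow> real vec \<Rightarrow> real \<Rightarrow> ('w \<Rightarrow> nat \<Rightarrow> real) \<Rightarrow> bool" where
  "gaussian_rv P n m t Y \<longleftrightarrow> Y \<in> P \<rightarrow>\<^sub>M Rn n \<and> distr P (Rn n) Y = gaussian n m t"

definition sqnorm :: "real vec \<Rightarrow> real" where
  "sqnorm v = v \<bullet> v"

definition tr :: "real mat \<Rightarrow> real" where
  "tr A = (\<Sum>i<dim_row A. A $$ (i, i))"

definition sel_cols :: "real mat \<Rightarrow> nat set \<Rightarrow> real mat" where
  "sel_cols X M = submatrix X UNIV M"

(* Meaningful when X_M^T X_M is invertible; otherwise "the None" is unspecified. *)
definition hat_mat :: "real mat \<Rightarrow> nat set \<Rightarrow> real mat" where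
  "hat_mat X M =
     (let XM = sel_cols X M in XM * the (mat_inverse (XM\<^sup>T * XM)) * XM\<^sup>T)"

(* The convention H_{} = 0 is a consequence of the general formula. *)
lemma hat_mat_empty:
  assumes "X \<in> carrier_mat n p"
  shows "hat_mat X {} = 0\<^sub>m n n"
proof -
  define Y where "Y = sel_cols X {}"
  have Y: "Y \<in> carrier_mat n 0"
    using assms by (auto simp: Y_def sel_cols_def submatrix_def)
  define A where "A = Y\<^sup>T * Y"
  have A: "A \<in> carrier_mat 0 0" using Y by (auto simp: A_def)
  have "A \<in> Units (ring_mat TYPE(real) 0 ())"
    using A by (auto simp: Units_def ring_mat_def intro!: bexI[of _ A] eq_matI)
  then obtain B where "mat_inverse A = Some B"
    using mat_inverse(1)[OF A, of "()"] by fastforce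
  with mat_inverse(2)[OF A this] have B: "the (mat_inverse A) \<in> carrier_mat 0 0" by simp
  show ?thesis
    unfolding hat_mat_def Let_def Y_def[symmetric] A_def[symmetric]
    using Y B by (intro eq_matI) (auto simp: scalar_prod_def)
qed

definition ErrHat ::
    "nat \<Rightarrow> real mat \<Rightarrow> ((nat \<Rightarrow> real) \<Rightarrow> nat set) \<Rightarrow> real \<Rightarrow> real
      \<Rightarrow> (nat \<Rightarrow> real) \<Rightarrow> (nat \<Rightarrow> real) \<Rightarrow> real" where
  "ErrHat n X Mhat \<sigma> \<alpha> y \<omega> =
     (let ystar  = (\<lambda>i\<in>{..<n}. y i + \<omega> i);
          yminus = vec n (\<lambda>i. y i - \<omega> i / \<alpha>);
          H = hat_mat X (Mhat ystar)
      in sqnorm (yminus - H *\<^sub>v vec n y) + 2 * tr H * \<sigma>\<^sup>2 - (1 / \<alpha>) * real n * \<sigma>\<^sup>2)"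

(* The regions U are only Lebesgue measurable (Borel up to the null boundary); hence integrals
   of quantities depending on Mhat are taken with respect to completed measures. *)
definition selection_map ::
    "nat \<Rightarrow> nat set set \<Rightarrow> ((nat \<Rightarrow> real) \<Rightarrow> nat set) \<Rightarrow> bool" where
  "selection_map n Ms Mhat \<longleftrightarrow>
     Mhat ` space (Rn n) = Ms \<and>
     (\<forall>M\<in>Ms. let U = {y \<in> space (Rn n). Mhat y = M} in
        top_Rn n interior_of U \<noteq> {} \<and> top_Rn n frontier_of U \<in> null_sets (Rn n))"

end

theory Submission
  imports Defs
begin

text \<open>
  Write \<open>e = y - \<mu>\<close>, \<open>H\<close> for the selected hat matrix and \<open>r = \<mu> - H \<mu>\<close>. Since \<open>H\<close> is an orthogonal
  projection, the deviation of the estimator from \<open>n \<sigma>\<^sup>2\<close> is a combination of \<open>|e|\<^sup>2\<close>, \<open>|\<omega>|\<^sup>2\<close> and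
  \<open>e \<bullet> \<omega>\<close> (centered, and free of the selection), of \<open>|r|\<^sup>2\<close>, which the accuracy condition controls,
  and of \<open>|H e|\<^sup>2\<close>, \<open>H e \<bullet> H \<omega>\<close>, \<open>r \<bullet> e\<close>, \<open>r \<bullet> \<omega>\<close> and \<open>tr H\<close>. By polarization
  \<open>e \<bullet> \<omega>\<close> reduces to squared norms, as \<open>y + \<omega>\<close> is again Gaussian. Decomposing every \<open>H\<^sub>M\<close> into at
  most \<open>k\<close> rank-one projections, the selection-dependent terms only involve inner products of \<open>e\<close>
  and \<open>\<omega>\<close> with a finite family of vectors of norm at most 1, of size at most
  \<open>(p + 1)^k (k + 1)\<close>; the maximum of their fourth powers has expectation of order \<open>(k log p)\<^sup>2\<close>, so
  these terms are \<open>O(k\<^sup>4 (log p)\<^sup>2) = O(n)\<close> in mean square.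
\<close>

section \<open>Orthogonal projections and hat matrices\<close>

text \<open>The selected \<open>H\<close> is a function of y + \<omega>, hence correlated with e and
  \<omega>, so it cannot be treated as fixed when moments of r . e, |H e|^2 or He . H\<omega> are
  taken; passing to a maximum over all candidate directions removes this dependence. The variance is
  bounded by the second moment about n \<sigma>^2: |e|^2 has mean n \<sigma>^2, and the mean n
  \<sigma>^2 / \<alpha> of |\<omega>|^2 / \<alpha>^2 is what the last term of the estimator
  subtracts. The deviation is multiplied by \<alpha> before being squared; since \<alpha> <
  \<delta>, all coefficients then stay bounded, and dividing the factor out again produces the 1 /
  \<alpha>^2 of the result. A term r . e is |r| times a form z in a unit direction, and 2 |r|^2 z^2
  \<le> |r|^4 + z^4; hence the fourth powers, and hence a second moment of |r|^2 is enough. That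
  moment is taken at variance (1 + \<alpha>) \<sigma>^2, the law of the selecting vector y +
  \<omega>. The size \<open>k\<close> is the minimum of K and p: when p = 1 the quantity K^2 log p
  vanishes and does not restrict K, while no model has more than p columns.\<close>

lemma projection_diagonal:
  fixes f :: "nat \<Rightarrow> nat \<Rightarrow> real"
  assumes "\<And>a b. a < n \<Longrightarrow> b < n \<Longrightarrow> f a b = f b a"
    and "\<And>a b. a < n \<Longrightarrow> b < n \<Longrightarrow> (\<Sum>c<n. f a c * f c b) = f a b"
    and "a < n"
  shows "(\<Sum>c<n. (f a c)\<^sup>2) = f a a"
proof -
  have "(\<Sum>c<n. (f a c)\<^sup>2) = (\<Sum>c<n. f a c * f c a)"
    using assms(1,3) by (intro sum.cong) (auto simp: power2_eq_square)
  also have "\<dots> = f a a" using assms(2)[OF assms(3,3)] .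
  finally show ?thesis .
qed

text \<open>Induction on the trace: a projection of positive trace has a nonzero column, and
  splitting off the projection onto that column lowers the trace by one. No eigenvectors are
  involved.\<close>

lemma projection_rank_one_decomposition:
  fixes f :: "nat \<Rightarrow> nat \<Rightarrow> real"
  assumes "\<And>a b. a < n \<Longrightarrow> b < n \<Longrightarrow> f a b = f b a"
    and "\<And>a b. a < n \<Longrightarrow> b < n \<Longrightarrow> (\<Sum>c<n. f a c * f c b) = f a b"
    and "(\<Sum>a<n. f a a) = real k"
  shows "\<exists>u. (\<forall>j<k. (\<Sum>a<n. (u j a)\<^sup>2) = 1) \<and>
    (\<forall>x. (\<Sum>a<n. \<Sum>b<n. x a * f a b * x b) = (\<Sum>j<k. (\<Sum>a<n. u j a * x a)\<^sup>2))"
  using assms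
proof (induction k arbitrary: f)
  case 0
  \<comment> \<open>With trace 0 the nonnegative diagonal vanishes; each diagonal entry is the
    squared norm of its row, so the whole matrix is zero.\<close>
  have diag: "(\<Sum>c<n. (f a c)\<^sup>2) = f a a" if "a < n" for a
    using projection_diagonal[of n f a] "0.prems"(1,2) that by blast
  have nn: "0 \<le> f a a" if "a < n" for a
    using diag[OF that] sum_nonneg[of "{..<n}" "\<lambda>c. (f a c)\<^sup>2"] by auto
  have "f a a = 0" if "a < n" for a
    using sum_nonneg_eq_0_iff[of "{..<n}" "\<lambda>a. f a a"] nn "0.prems"(3) that by auto
  then have "f a c = 0" if "a < n" "c < n" for a c
    using diag[OF that(1)] that sum_nonneg_eq_0_iff[of "{..<n}" "\<lambda>c. (f a c)\<^sup>2"] by auto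
  then show ?case by simp
next
  case (Suc k)
  note sym = Suc.prems(1) and idem = Suc.prems(2)
  have diag: "(\<Sum>c<n. (f a c)\<^sup>2) = f a a" if "a < n" for a
    using projection_diagonal[of n f a] sym idem that by blast
  have "\<exists>i<n. f i i \<noteq> 0"
  proof (rule ccontr)
    assume "\<not> ?thesis"
    then have "(\<Sum>a<n. f a a) = 0" by simp
    with Suc.prems(3) show False by simp
  qed
  then obtain i where i: "i < n" "f i i \<noteq> 0" by blast
  define d where "d = f i i"
  have d: "d > 0"
    using diag[OF i(1)] sum_nonneg[of "{..<n}" "\<lambda>c. (f i c)\<^sup>2"] i unfolding d_def by auto
  \<comment> \<open>Column \<open>i\<close> lies in the range of \<open>f\<close> and has squared
    norm \<open>d\<close> (the fact \<open>sq\<close>), so the subtracted term is the orthogonal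
    projection onto it and \<open>g\<close> is again a projection.\<close>
  define g where "g a b = f a b - f a i * f b i / d" for a b
  have sq: "(\<Sum>c<n. f c i * f c i) = d"
    using idem[OF i(1) i(1)] sym[OF i(1)] by (simp add: d_def)
  have g1: "g a b = g b a" if "a < n" "b < n" for a b
    using sym[OF that] by (simp add: g_def mult.commute)
  have g2: "(\<Sum>c<n. g a c * g c b) = g a b" if ab: "a < n" "b < n" for a b
  proof -
    have "(\<Sum>c<n. g a c * g c b) = (\<Sum>c<n. f a c * f c b - (f b i / d) * (f a c * f c i)
       - (f a i / d) * (f b c * f c i) + (f a i * f b i / (d * d)) * (f c i * f c i))"
      using d by (intro sum.cong refl) (simp add: g_def algebra_simps sym[OF ab(2)])
    also have "\<dots> = f a b - (f b i / d) * f a i - (f a i / d) * f b i + (f a i * f b i / (d * d)) * d"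
      unfolding sum.distrib sum_subtractf sum_distrib_left[symmetric]
      using idem[OF ab] idem[OF ab(1) i(1)] idem[OF ab(2) i(1)] sq by simp
    also have "\<dots> = g a b" using d by (simp add: g_def)
    finally show ?thesis .
  qed
  have g3: "(\<Sum>a<n. g a a) = real k"
    using Suc.prems(3) sq d by (simp add: g_def sum_subtractf sum_divide_distrib[symmetric])
  from Suc.IH[OF g1 g2 g3] obtain u where
    u: "\<And>j. j < k \<Longrightarrow> (\<Sum>a<n. (u j a)\<^sup>2) = 1"
    "\<And>x. (\<Sum>a<n. \<Sum>b<n. x a * g a b * x b) = (\<Sum>j<k. (\<Sum>a<n. u j a * x a)\<^sup>2)" by blast
  define v where "v j = (if j < k then u j else (\<lambda>a. f a i / sqrt d))" for j
  have "(\<Sum>a<n. (v j a)\<^sup>2) = 1" if "j < Suc k" for j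
    using that u(1)[of j] sq d
    by (auto simp: v_def power_divide sum_divide_distrib[symmetric] power2_eq_square)
  moreover have "(\<Sum>a<n. \<Sum>b<n. x a * f a b * x b) = (\<Sum>j<Suc k. (\<Sum>a<n. v j a * x a)\<^sup>2)" for x
  proof -
    have "(\<Sum>a<n. v k a * x a)\<^sup>2 = (\<Sum>a<n. \<Sum>b<n. x a * (f a i * f b i / d) * x b)"
      using d by (simp add: v_def power2_eq_square sum_product mult_ac)
    moreover have "(\<Sum>j<k. (\<Sum>a<n. v j a * x a)\<^sup>2) = (\<Sum>a<n. \<Sum>b<n. x a * g a b * x b)"
      unfolding u(2) by (simp add: v_def)
    ultimately show ?thesis
      by (simp add: g_def sum.distrib[symmetric] algebra_simps)
  qed
  ultimately show ?case by blast
qed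

text \<open>With an invertible Gram matrix A, \<open>the (mat_inverse A)\<close> is a genuine
  two-sided inverse, symmetric because A is. The trace equals the model size by cyclicity.\<close>

lemma hat_mat_properties:
  assumes X: "X \<in> carrier_mat n p" and M: "M \<subseteq> {..<p}"
    and inv: "invertible_mat ((sel_cols X M)\<^sup>T * sel_cols X M)"
  shows "hat_mat X M \<in> carrier_mat n n"
    and "(hat_mat X M)\<^sup>T = hat_mat X M"
    and "hat_mat X M * hat_mat X M = hat_mat X M"
    and "tr (hat_mat X M) = real (card M)"
proof -
  define Y where "Y = sel_cols X M"
  define k where "k = card M"
  have "{j. j < p \<and> j \<in> M} = M" using M by auto
  then have Y: "Y \<in> carrier_mat n k"
    using carrier_matD[OF X]
    by (intro carrier_matI) (simp_all add: Y_def sel_cols_def k_def dim_submatrix)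
  have YT: "Y\<^sup>T \<in> carrier_mat k n" using Y by simp
  define A where "A = Y\<^sup>T * Y"
  have A: "A \<in> carrier_mat k k" using Y by (auto simp: A_def)
  from inv obtain C where C: "A * C = 1\<^sub>m k" "C * A = 1\<^sub>m (dim_row C)"
    using A unfolding invertible_mat_def inverts_mat_def A_def Y_def by auto
  have "dim_col C = k" using arg_cong[OF C(1), of dim_col] by simp
  moreover have "dim_row C = k" using arg_cong[OF C(2), of dim_col] A by simp
  ultimately have "C \<in> carrier_mat k k" by auto
  with C A have "A \<in> Units (ring_mat TYPE(real) k ())"
    by (auto simp: Units_def ring_mat_def)
  then obtain B where B0: "mat_inverse A = Some B"
    using mat_inverse(1)[OF A, of "()"] by fastforce
  from mat_inverse(2)[OF A B0] have AB: "A * B = 1\<^sub>m k" and BA: "B * A = 1\<^sub>m k"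
    and B: "B \<in> carrier_mat k k" by auto
  have H: "hat_mat X M = Y * B * Y\<^sup>T"
    unfolding hat_mat_def Let_def Y_def[symmetric] A_def[symmetric] B0 by simp
  have AT: "A\<^sup>T = A" unfolding A_def using Y YT by (simp add: transpose_mult[OF YT Y])
  have BT: "B\<^sup>T \<in> carrier_mat k k" using B by simp
  have "B\<^sup>T * A = 1\<^sub>m k"
    using transpose_mult[OF A B] AB AT by simp
  \<comment> \<open>Uniqueness of the inverse: \<open>B\<close> transposed is a left inverse of the
    symmetric \<open>A\<close>, and \<open>B\<close> is a right inverse.\<close>
  have "B\<^sup>T = B\<^sup>T * (A * B)" using AB BT by simp
  also have "\<dots> = (B\<^sup>T * A) * B" using A B BT by simp
  also have "\<dots> = B" using \<open>B\<^sup>T * A = 1\<^sub>m k\<close> B by simp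
  finally have BTB: "B\<^sup>T = B" .
  have YB: "Y * B \<in> carrier_mat n k" and BY: "B * Y\<^sup>T \<in> carrier_mat k n" using Y B by auto
  show "hat_mat X M \<in> carrier_mat n n" unfolding H using YB YT by auto
  show "(hat_mat X M)\<^sup>T = hat_mat X M"
    unfolding H using Y B YT YB by (simp add: transpose_mult[OF Y BY] transpose_mult[OF B YT] BTB assoc_mult_mat[OF Y B YT])
  have "hat_mat X M * hat_mat X M = (Y * B) * (Y\<^sup>T * (Y * (B * Y\<^sup>T)))"
    unfolding H using Y B YT YB BY assoc_mult_mat[OF YB YT, of "Y * B * Y\<^sup>T" n]
      assoc_mult_mat[OF Y B YT] by simp
  also have "Y\<^sup>T * (Y * (B * Y\<^sup>T)) = A * (B * Y\<^sup>T)"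
    unfolding A_def using assoc_mult_mat[OF YT Y BY] by simp
  also have "\<dots> = (A * B) * Y\<^sup>T" using assoc_mult_mat[OF A B YT] by simp
  finally show "hat_mat X M * hat_mat X M = hat_mat X M"
    unfolding H AB using YT by simp
  \<comment> \<open>Cyclicity of the trace, written out: the n by n product has the trace of the k
    by k identity.\<close>
  have "tr (hat_mat X M) = (\<Sum>a<n. \<Sum>c<k. (Y * B) $$ (a, c) * Y\<^sup>T $$ (c, a))"
    unfolding H tr_def using YB YT Y by (auto simp: scalar_prod_def atLeast0LessThan intro!: sum.cong)
  also have "\<dots> = (\<Sum>c<k. \<Sum>a<n. Y\<^sup>T $$ (c, a) * (Y * B) $$ (a, c))"
    by (subst sum.swap) (simp add: mult.commute)
  also have "\<dots> = tr (Y\<^sup>T * (Y * B))"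
    unfolding tr_def using YB Y
    by (intro sum.cong) (auto simp: scalar_prod_def atLeast0LessThan index_mult_mat(1)[of _ "Y\<^sup>T" _ "Y * B"]
        simp del: index_mult_mat(1) intro!: sum.cong)
  also have "Y\<^sup>T * (Y * B) = 1\<^sub>m k"
    using assoc_mult_mat[OF YT Y B] AB by (simp add: A_def)
  finally show "tr (hat_mat X M) = real (card M)" by (simp add: tr_def k_def)
qed

section \<open>Gaussian vectors\<close>

lemma space_Rn: "space (Rn n) = extensional {..<n}"
  by (auto simp: Rn_def space_PiM PiE_def)

lemma measurable_Rn_component[measurable]: "i < n \<Longrightarrow> (\<lambda>x. x i) \<in> borel_measurable (Rn n)"
  unfolding Rn_def by (rule measurable_PiM_component_rev[where N = lborel, simplified]) auto

lemma product_prob_space_normal: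
  assumes "t > 0"
  shows "product_prob_space (\<lambda>i. density lborel (normal_density (m i) (sqrt t)))"
proof -
  interpret prob_space "density lborel (normal_density (m i) (sqrt t))" for i
    using assms by (intro prob_space_normal_density) simp
  show ?thesis by unfold_locales
qed

lemma prob_space_gaussian: "t > 0 \<Longrightarrow> prob_space (gaussian n m t)"
  unfolding gaussian_def
  by (intro prob_space_PiM prob_space_normal_density) simp

lemma sets_gaussian[measurable_cong]: "sets (gaussian n m t) = sets (Rn n)"
  unfolding gaussian_def Rn_def by (intro sets_PiM_cong) auto

lemma space_gaussian: "space (gaussian n m t) = space (Rn n)"
  by (rule sets_eq_imp_space_eq[OF sets_gaussian])

text \<open>Gives absolute continuity with respect to Lebesgue measure, so that the Lebesgue-null
  frontiers of the selection regions are also null for every Gaussian law in use. Both measures are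
  compared on boxes.\<close>

lemma gaussian_eq_density:
  assumes "t > 0"
  shows "gaussian n m t = density (Rn n) (\<lambda>x. \<Prod>i<n. ennreal (normal_density (m $ i) (sqrt t) (x i)))"
proof -
  interpret N: product_prob_space "\<lambda>i. density lborel (normal_density (m $ i) (sqrt t))"
    using assms by (rule product_prob_space_normal)
  interpret L: product_sigma_finite "\<lambda>_::nat. lborel :: real measure"
    by unfold_locales
  have dens[measurable]: "(\<lambda>x. \<Prod>i<n. ennreal (normal_density (m $ i) (sqrt t) (x i)))
    \<in> borel_measurable (Rn n)"
    by measurable
  show ?thesis
    unfolding gaussian_def
  proof (rule N.PiM_eqI[symmetric])
    show "sets (density (Rn n) (\<lambda>x. \<Prod>i<n. ennreal (normal_density (m $ i) (sqrt t) (x i))))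
      = sets (PiM {..<n} (\<lambda>i. density lborel (normal_density (m $ i) (sqrt t))))"
      using sets_gaussian[of n m t] by (simp add: gaussian_def)
    fix A assume "\<And>i. i \<in> {..<n} \<Longrightarrow> A i \<in> sets (density lborel (normal_density (m $ i) (sqrt t)))"
    then have A[measurable]: "\<And>i. i < n \<Longrightarrow> A i \<in> sets borel" by simp
    have "Pi\<^sub>E {..<n} A \<in> sets (Rn n)" unfolding Rn_def by (intro sets_PiM_I_finite) auto
    then have "emeasure (density (Rn n) (\<lambda>x. \<Prod>i<n. ennreal (normal_density (m $ i) (sqrt t) (x i)))) (Pi\<^sub>E {..<n} A)
      = (\<integral>\<^sup>+x. (\<Prod>i<n. ennreal (normal_density (m $ i) (sqrt t) (x i))) * indicator (Pi\<^sub>E {..<n} A) x \<partial>Rn n)"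
      by (intro emeasure_density dens)
    also have "\<dots> = (\<integral>\<^sup>+x. (\<Prod>i<n. ennreal (normal_density (m $ i) (sqrt t) (x i)) * indicator (A i) (x i)) \<partial>Rn n)"
    proof (intro nn_integral_cong)
      fix x assume "x \<in> space (Rn n)"
      then have "indicator (Pi\<^sub>E {..<n} A) x = (\<Prod>i<n. indicator (A i) (x i) :: ennreal)"
        by (auto simp: space_Rn PiE_def indicator_def Pi_iff)
      then show "(\<Prod>i<n. ennreal (normal_density (m $ i) (sqrt t) (x i))) * indicator (Pi\<^sub>E {..<n} A) x
        = (\<Prod>i<n. ennreal (normal_density (m $ i) (sqrt t) (x i)) * indicator (A i) (x i))"
        by (simp add: prod.distrib)
    qed
    also have "\<dots> = (\<Prod>i<n. \<integral>\<^sup>+x. ennreal (normal_density (m $ i) (sqrt t) x) * indicator (A i) x \<partial>lborel)"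
      unfolding Rn_def by (rule L.product_nn_integral_prod) (auto intro!: borel_measurable_times_ennreal)
    also have "\<dots> = (\<Prod>i<n. emeasure (density lborel (normal_density (m $ i) (sqrt t))) (A i))"
      by (intro prod.cong refl emeasure_density[symmetric]) auto
    finally show "emeasure (density (Rn n) (\<lambda>x. \<Prod>i<n. ennreal (normal_density (m $ i) (sqrt t) (x i)))) (Pi\<^sub>E {..<n} A)
      = (\<Prod>i<n. emeasure (density lborel (normal_density (m $ i) (sqrt t))) (A i))" .
  qed simp
qed

lemma null_sets_gaussian:
  assumes "t > 0" "N \<in> null_sets (Rn n)"
  shows "N \<in> null_sets (gaussian n m t)"
proof -
  have "AE x in Rn n. x \<notin> N" using assms(2) by (rule AE_not_in)
  then have "AE x in gaussian n m t. x \<notin> N"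
    unfolding gaussian_eq_density[OF assms(1)] by (subst AE_density) (auto)
  moreover have "N \<in> sets (gaussian n m t)" using assms(2) by (auto simp: sets_gaussian)
  ultimately show ?thesis by (simp add: AE_iff_null_sets)
qed

text \<open>Completing the square: the exponential tilt moves the mean from m to m + a t and leaves
  the factor exp (t a^2 / 2). Stated as a nonnegative integral, it needs no prior
  integrability.\<close>

lemma normal_mgf:
  assumes "t > 0"
  shows "(\<integral>\<^sup>+x. ennreal (exp (a * (x - m))) \<partial>density lborel (normal_density m (sqrt t)))
    = ennreal (exp (t / 2 * a\<^sup>2))"
proof -
  have eq: "normal_density m (sqrt t) x * exp (a * (x - m))
    = exp (t / 2 * a\<^sup>2) * normal_density (m + a * t) (sqrt t) x" for x
  proof -
    have "- (x - m)\<^sup>2 / (2 * t) + a * (x - m) = t / 2 * a\<^sup>2 - (x - (m + a * t))\<^sup>2 / (2 * t)"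
      using assms by (simp add: field_simps power2_eq_square)
    then have "exp (- (x - m)\<^sup>2 / (2 * t)) * exp (a * (x - m))
      = exp (t / 2 * a\<^sup>2) * exp (- (x - (m + a * t))\<^sup>2 / (2 * t))"
      by (simp add: exp_add[symmetric])
    then show ?thesis using assms by (simp add: normal_density_def)
  qed
  interpret P: prob_space "density lborel (normal_density (m + a * t) (sqrt t))"
    using assms by (intro prob_space_normal_density) simp
  have one: "(\<integral>\<^sup>+x. ennreal (normal_density (m + a * t) (sqrt t) x) \<partial>lborel) = 1"
    using P.emeasure_space_1 by (simp add: emeasure_density)
  have "(\<integral>\<^sup>+x. ennreal (exp (a * (x - m))) \<partial>density lborel (normal_density m (sqrt t)))
    = (\<integral>\<^sup>+x. ennreal (exp (t / 2 * a\<^sup>2)) * ennreal (normal_density (m + a * t) (sqrt t) x) \<partial>lborel)"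
    by (subst nn_integral_density) (auto simp: ennreal_mult[symmetric] eq)
  then show ?thesis by (simp add: nn_integral_cmult one)
qed

lemma gaussian_mgf:
  assumes "t > 0"
  shows "(\<integral>\<^sup>+x. ennreal (exp (\<Sum>i<n. v i * (x i - m $ i))) \<partial>gaussian n m t)
    = ennreal (exp (t / 2 * (\<Sum>i<n. (v i)\<^sup>2)))"
proof -
  interpret N: product_prob_space "\<lambda>i. density lborel (normal_density (m $ i) (sqrt t))"
    using assms by (rule product_prob_space_normal)
  have "(\<integral>\<^sup>+x. ennreal (exp (\<Sum>i<n. v i * (x i - m $ i))) \<partial>gaussian n m t)
    = (\<integral>\<^sup>+x. (\<Prod>i<n. ennreal (exp (v i * (x i - m $ i)))) \<partial>gaussian n m t)"
    by (simp add: exp_sum prod_ennreal)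
  also have "\<dots> = (\<Prod>i<n. \<integral>\<^sup>+x. ennreal (exp (v i * (x - m $ i)))
      \<partial>density lborel (normal_density (m $ i) (sqrt t)))"
    unfolding gaussian_def by (rule N.product_nn_integral_prod) auto
  also have "\<dots> = ennreal (exp (t / 2 * (\<Sum>i<n. (v i)\<^sup>2)))"
    by (simp add: normal_mgf[OF assms] prod_ennreal exp_sum sum_distrib_left)
  finally show ?thesis .
qed

lemma normal_centered_square:
  fixes t m :: real
  assumes "t > 0"
  defines "N \<equiv> density lborel (normal_density m (sqrt t))"
  shows "has_bochner_integral N (\<lambda>x. (x - m)\<^sup>2 - t) 0"
    and "has_bochner_integral N (\<lambda>x. ((x - m)\<^sup>2 - t)\<^sup>2) (2 * t\<^sup>2)"
proof -
  let ?d = "normal_density m (sqrt t)"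
  have s: "0 < sqrt t" using assms by simp
  have 0: "has_bochner_integral lborel ?d 1"
    using normal_moment_even[OF s, of m 0] by simp
  have 2: "has_bochner_integral lborel (\<lambda>x. ?d x * (x - m)\<^sup>2) t"
    using normal_moment_even[OF s, of m 1] assms by simp
  have 4: "has_bochner_integral lborel (\<lambda>x. ?d x * (x - m)^4) (3 * t\<^sup>2)"
    using normal_moment_even[OF s, of m 2] assms
    by (simp add: fact_numeral power_divide field_simps)
  have "has_bochner_integral lborel (\<lambda>x. ?d x * (x - m)\<^sup>2 - t * ?d x) (t - t * 1)"
    by (intro has_bochner_integral_diff has_bochner_integral_mult_right 0 2)
  then have "has_bochner_integral lborel (\<lambda>x. ?d x *\<^sub>R ((x - m)\<^sup>2 - t)) 0"
    by (simp add: algebra_simps)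
  then show "has_bochner_integral N (\<lambda>x. (x - m)\<^sup>2 - t) 0"
    unfolding N_def by (intro has_bochner_integral_density) auto
  have "has_bochner_integral lborel (\<lambda>x. ?d x * (x - m)^4 - (2 * t) * (?d x * (x - m)\<^sup>2) + t\<^sup>2 * ?d x)
      (3 * t\<^sup>2 - (2 * t) * t + t\<^sup>2 * 1)"
    by (intro has_bochner_integral_diff has_bochner_integral_add has_bochner_integral_mult_right 0 2 4)
  moreover have "?d x * (x - m)^4 - (2 * t) * (?d x * (x - m)\<^sup>2) + t\<^sup>2 * ?d x
      = ?d x *\<^sub>R ((x - m)\<^sup>2 - t)\<^sup>2" for x
    by (simp add: power2_eq_square power4_eq_xxxx algebra_simps)
  moreover have "3 * t\<^sup>2 - (2 * t) * t + t\<^sup>2 * 1 = 2 * t\<^sup>2"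
    by (simp add: power2_eq_square)
  ultimately have "has_bochner_integral lborel (\<lambda>x. ?d x *\<^sub>R ((x - m)\<^sup>2 - t)\<^sup>2) (2 * t\<^sup>2)"
    by simp
  then show "has_bochner_integral N (\<lambda>x. ((x - m)\<^sup>2 - t)\<^sup>2) (2 * t\<^sup>2)"
    unfolding N_def by (intro has_bochner_integral_density) auto
qed

text \<open>The centered squares of distinct coordinates are independent with mean 0, so only the n
  diagonal terms of the expanded square survive, each contributing 2 t^2.\<close>

lemma gaussian_centered_sqnorm:
  assumes "t > 0"
  shows "has_bochner_integral (gaussian n m t) (\<lambda>x. ((\<Sum>i<n. (x i - m $ i)\<^sup>2) - real n * t)\<^sup>2)
    (2 * real n * t\<^sup>2)"
proof -
  let ?N = "\<lambda>i. density lborel (normal_density (m $ i) (sqrt t))"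
  interpret N: product_prob_space ?N
    using assms by (rule product_prob_space_normal)
  define f where "f i x = (x - m $ i)\<^sup>2 - t" for i x
  \<comment> \<open>Padding with the factor 1 writes f_i f_j as a product over all coordinates, the
    form that the product integral theorem expects; for i = j the two factors combine to a
    square.\<close>
  define h where "h i j k x = (if k = i then f k x else 1) * (if k = j then f k x else 1)"
    for i j k :: nat and x
  note sq = normal_centered_square[OF assms]
  have h: "has_bochner_integral (?N k) (h i j k)
    (if k = i \<and> k = j then 2 * t\<^sup>2 else if k = i \<or> k = j then 0 else 1)" for i j k
  proof -
    have "has_bochner_integral (?N k) (\<lambda>_. 1) (1::real)"
      using N.M.prob_space by (simp add: has_bochner_integral_iff)
    then show ?thesis
      using sq[of "m $ k"] unfolding h_def[abs_def] f_def
      by (cases "k = i"; cases "k = j") (simp_all flip: power2_eq_square)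
  qed
  have "has_bochner_integral (gaussian n m t) (\<lambda>x. f i (x i) * f j (x j)) (if i = j then 2 * t\<^sup>2 else 0)"
    if ij: "i < n" "j < n" for i j
  proof -
    have "(\<lambda>x. f i (x i) * f j (x j)) = (\<lambda>x. \<Prod>k<n. h i j k (x k))"
      using ij by (simp add: h_def prod.distrib prod.delta)
    moreover have "integrable (gaussian n m t) (\<lambda>x. \<Prod>k<n. h i j k (x k))"
      unfolding gaussian_def
      using h by (intro N.product_integrable_prod) (auto simp: has_bochner_integral_iff)
    moreover have "(\<integral>x. (\<Prod>k<n. h i j k (x k)) \<partial>gaussian n m t) = (\<Prod>k<n. integral\<^sup>L (?N k) (h i j k))"
      unfolding gaussian_def
      using h by (intro N.product_integral_prod) (auto simp: has_bochner_integral_iff)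
    moreover have "(\<Prod>k<n. integral\<^sup>L (?N k) (h i j k)) = (if i = j then 2 * t\<^sup>2 else 0)"
    proof (cases "i = j")
      case True
      then show ?thesis
        using ij by (simp add: has_bochner_integral_integral_eq[OF h] prod.delta cong: if_cong)
    next
      case False
      then have "integral\<^sup>L (?N i) (h i j i) = 0" by (simp add: has_bochner_integral_integral_eq[OF h])
      then show ?thesis using ij False by (auto intro!: prod_zero)
    qed
    ultimately show ?thesis by (simp add: has_bochner_integral_iff)
  qed
  then have "has_bochner_integral (gaussian n m t) (\<lambda>x. \<Sum>i<n. \<Sum>j<n. f i (x i) * f j (x j))
      (\<Sum>i<n. \<Sum>j<n. if i = j then 2 * t\<^sup>2 else 0)"
    by (intro has_bochner_integral_sum) auto
  moreover have "((\<Sum>i<n. (x i - m $ i)\<^sup>2) - real n * t)\<^sup>2 = (\<Sum>i<n. \<Sum>j<n. f i (x i) * f j (x j))" for x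
    unfolding sum_product[symmetric] power2_eq_square
    by (simp add: f_def sum_subtractf power2_eq_square)
  ultimately show ?thesis by (simp add: sum.delta mult_ac)
qed

text \<open>The two laws are realized as the coordinates of their product space; these are
  independent, so the theorem on sums of independent normal variables applies.\<close>

lemma normal_add:
  fixes a b s t :: real
  assumes s: "s > 0" and t: "t > 0"
  defines "A \<equiv> density lborel (normal_density a (sqrt s))"
    and "B \<equiv> density lborel (normal_density b (sqrt t))"
  shows "distr (A \<Otimes>\<^sub>M B) borel (\<lambda>(x, y). x + y) = density lborel (normal_density (a + b) (sqrt (s + t)))"
proof -
  interpret A: prob_space A using s unfolding A_def by (intro prob_space_normal_density) simp
  interpret B: prob_space B using t unfolding B_def by (intro prob_space_normal_density) simp
  interpret AB: pair_prob_space A B by unfold_locales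
  have [measurable_cong, simp]: "sets A = sets borel" "sets B = sets borel" by (auto simp: A_def B_def)
  have dA: "distr (A \<Otimes>\<^sub>M B) borel fst = A"
    using B.distr_pair_fst[of A] distr_cong[of "A \<Otimes>\<^sub>M B" "A \<Otimes>\<^sub>M B" A borel fst fst] by simp
  have dB: "distr (A \<Otimes>\<^sub>M B) borel snd = B"
  proof (rule measure_eqI)
    fix E assume "E \<in> sets (distr (A \<Otimes>\<^sub>M B) borel snd)"
    then have E: "E \<in> sets borel" by simp
    then have "snd -` E \<inter> space (A \<Otimes>\<^sub>M B) = space A \<times> E"
      by (auto simp: space_pair_measure A_def B_def)
    then show "emeasure (distr (A \<Otimes>\<^sub>M B) borel snd) E = emeasure B E"
      using E B.emeasure_pair_measure_Times[OF sets.top[of A], of E]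
      by (simp add: emeasure_distr A.emeasure_space_1)
  qed simp
  have "AB.indep_var borel fst borel snd"
  proof (subst AB.indep_var_distribution_eq, intro conjI)
    show "distr (A \<Otimes>\<^sub>M B) borel fst \<Otimes>\<^sub>M distr (A \<Otimes>\<^sub>M B) borel snd =
        distr (A \<Otimes>\<^sub>M B) (borel \<Otimes>\<^sub>M borel) (\<lambda>x. (fst x, snd x))"
      unfolding dA dB
      using distr_cong[of "A \<Otimes>\<^sub>M B" "A \<Otimes>\<^sub>M B" "A \<Otimes>\<^sub>M B" "borel \<Otimes>\<^sub>M borel" "\<lambda>x. x" "\<lambda>x. x"]
      by (simp cong: sets_pair_measure_cong)
  qed auto
  moreover have "distributed (A \<Otimes>\<^sub>M B) lborel fst (normal_density a (sqrt s))"
    unfolding distributed_def using dA distr_cong[of "A \<Otimes>\<^sub>M B" "A \<Otimes>\<^sub>M B" lborel borel fst fst]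
    by (auto simp: A_def)
  moreover have "distributed (A \<Otimes>\<^sub>M B) lborel snd (normal_density b (sqrt t))"
    unfolding distributed_def using dB distr_cong[of "A \<Otimes>\<^sub>M B" "A \<Otimes>\<^sub>M B" lborel borel snd snd]
    by (auto simp: B_def)
  ultimately have "distributed (A \<Otimes>\<^sub>M B) lborel (\<lambda>x. fst x + snd x)
      (normal_density (a + b) (sqrt ((sqrt s)\<^sup>2 + (sqrt t)\<^sup>2)))"
    using s t by (intro AB.add_indep_normal) auto
  then have "distr (A \<Otimes>\<^sub>M B) lborel (\<lambda>x. fst x + snd x) = density lborel (normal_density (a + b) (sqrt (s + t)))"
    using s t by (simp add: distributed_def)
  then show ?thesis
    using distr_cong[of "A \<Otimes>\<^sub>M B" "A \<Otimes>\<^sub>M B" lborel borel "\<lambda>x. fst x + snd x" "\<lambda>x. fst x + snd x"]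
    by (simp add: case_prod_beta')
qed

lemma gaussian_add:
  assumes s: "s > 0" and t: "t > 0" and m': "m' \<in> carrier_vec n"
  shows "distr (gaussian n m s \<Otimes>\<^sub>M gaussian n m' t) (Rn n) (\<lambda>(x, y). \<lambda>i\<in>{..<n}. x i + y i)
    = gaussian n (m + m') (s + t)"
proof -
  let ?A = "\<lambda>i. density lborel (normal_density (m $ i) (sqrt s))"
  let ?B = "\<lambda>i. density lborel (normal_density (m' $ i) (sqrt t))"
  let ?C = "\<lambda>i. density lborel (normal_density ((m + m') $ i) (sqrt (s + t)))"
  let ?G = "gaussian n m s" and ?G' = "gaussian n m' t"
  interpret A: product_prob_space ?A using s by (rule product_prob_space_normal)
  interpret B: product_prob_space ?B using t by (rule product_prob_space_normal)
  interpret C: product_prob_space ?C using s t by (intro product_prob_space_normal) simp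
  interpret G: prob_space ?G using s by (rule prob_space_gaussian)
  interpret G': prob_space ?G' using t by (rule prob_space_gaussian)
  have plus: "(\<lambda>(x, y). \<lambda>i\<in>{..<n}. x i + y i) \<in> ?G \<Otimes>\<^sub>M ?G' \<rightarrow>\<^sub>M Rn n"
    unfolding Rn_def[of n] by measurable
  show ?thesis
    unfolding gaussian_def[of n "m + m'"]
  proof (rule C.PiM_eqI)
    show "sets (distr (?G \<Otimes>\<^sub>M ?G') (Rn n) (\<lambda>(x, y). \<lambda>i\<in>{..<n}. x i + y i)) = sets (PiM {..<n} ?C)"
      using sets_gaussian[of n "m + m'" "s + t"] by (simp add: gaussian_def)
    fix E assume "\<And>i. i \<in> {..<n} \<Longrightarrow> E i \<in> sets (?C i)"
    then have E[measurable]: "\<And>i. i < n \<Longrightarrow> E i \<in> sets borel" by simp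
    have [measurable]: "Pi\<^sub>E {..<n} E \<in> sets (Rn n)" unfolding Rn_def by (intro sets_PiM_I_finite) auto
    have [measurable]: "\<And>i. i < n \<Longrightarrow> (\<lambda>(x, y). indicator (E i) (x + y) :: ennreal) \<in> borel_measurable (borel \<Otimes>\<^sub>M borel)"
      by measurable
    have "emeasure (distr (?G \<Otimes>\<^sub>M ?G') (Rn n) (\<lambda>(x, y). \<lambda>i\<in>{..<n}. x i + y i)) (Pi\<^sub>E {..<n} E)
      = (\<integral>\<^sup>+z. indicator (Pi\<^sub>E {..<n} E) z \<partial>distr (?G \<Otimes>\<^sub>M ?G') (Rn n) (\<lambda>(x, y). \<lambda>i\<in>{..<n}. x i + y i))"
      by simp
    also have "\<dots> = (\<integral>\<^sup>+z. indicator (Pi\<^sub>E {..<n} E) (\<lambda>i\<in>{..<n}. fst z i + snd z i) \<partial>(?G \<Otimes>\<^sub>M ?G'))"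
      using plus by (subst nn_integral_distr) (auto simp: case_prod_beta')
    also have "\<dots> = (\<integral>\<^sup>+z. (\<Prod>i<n. indicator (E i) (fst z i + snd z i)) \<partial>(?G \<Otimes>\<^sub>M ?G'))"
      by (intro nn_integral_cong) (auto simp: PiE_def indicator_def Pi_iff)
    also have "\<dots> = (\<integral>\<^sup>+x. \<integral>\<^sup>+y. (\<Prod>i<n. indicator (E i) (x i + y i)) \<partial>?G' \<partial>?G)"
      by (subst G'.nn_integral_fst[symmetric]) auto
    also have "\<dots> = (\<integral>\<^sup>+x. (\<Prod>i<n. \<integral>\<^sup>+y. indicator (E i) (x i + y) \<partial>?B i) \<partial>?G)"
      unfolding gaussian_def[of n m']
      by (intro nn_integral_cong B.product_nn_integral_prod) auto
    also have "\<dots> = (\<Prod>i<n. \<integral>\<^sup>+x. \<integral>\<^sup>+y. indicator (E i) (x + y) \<partial>?B i \<partial>?A i)"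
      unfolding gaussian_def[of n m] by (intro A.product_nn_integral_prod) auto
    also have "\<dots> = (\<Prod>i<n. emeasure (?C i) (E i))"
    proof (intro prod.cong refl)
      fix i assume "i \<in> {..<n}"
      then have i: "i < n" by simp
      have "(\<integral>\<^sup>+x. \<integral>\<^sup>+y. indicator (E i) (x + y) \<partial>?B i \<partial>?A i)
        = (\<integral>\<^sup>+z. indicator (E i) (fst z + snd z) \<partial>(?A i \<Otimes>\<^sub>M ?B i))"
        using i by (subst B.M.nn_integral_fst[symmetric]) auto
      also have "\<dots> = (\<integral>\<^sup>+z. indicator (E i) z \<partial>distr (?A i \<Otimes>\<^sub>M ?B i) borel (\<lambda>(x, y). x + y))"
        using i by (subst nn_integral_distr) (auto simp: case_prod_beta')
      also have "\<dots> = emeasure (?C i) (E i)"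
        \<comment> \<open>A vector sum takes its dimension from the second summand, so the carrier
          of \<open>m'\<close> is what justifies reading off the component of
          \<open>m + m'\<close>.\<close>
        unfolding normal_add[OF s t] using i m' by simp
      finally show "(\<integral>\<^sup>+x. \<integral>\<^sup>+y. indicator (E i) (x + y) \<partial>?B i \<partial>?A i) = emeasure (?C i) (E i)" .
    qed
    finally show "emeasure (distr (?G \<Otimes>\<^sub>M ?G') (Rn n) (\<lambda>(x, y). \<lambda>i\<in>{..<n}. x i + y i)) (Pi\<^sub>E {..<n} E)
      = (\<Prod>i<n. emeasure (?C i) (E i))" .
  qed simp
qed

lemma gaussian_rv_add:
  assumes "prob_space P" "gaussian_rv P n m s y" "gaussian_rv P n m' t \<omega>"
    and "prob_space.indep_var P (Rn n) y (Rn n) \<omega>"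
    and s: "s > 0" and t: "t > 0" and m': "m' \<in> carrier_vec n"
  shows "gaussian_rv P n (m + m') (s + t) (\<lambda>w. \<lambda>i\<in>{..<n}. y w i + \<omega> w i)"
proof -
  interpret prob_space P by fact
  have [measurable]: "y \<in> P \<rightarrow>\<^sub>M Rn n" "\<omega> \<in> P \<rightarrow>\<^sub>M Rn n"
    and d: "distr P (Rn n) y = gaussian n m s" "distr P (Rn n) \<omega> = gaussian n m' t"
    using assms by (auto simp: gaussian_rv_def)
  have plus[measurable]: "(\<lambda>(x, y). \<lambda>i\<in>{..<n}. x i + y i) \<in> Rn n \<Otimes>\<^sub>M Rn n \<rightarrow>\<^sub>M Rn n"
    unfolding Rn_def[of n] by measurable
  have "gaussian n m s \<Otimes>\<^sub>M gaussian n m' t = distr P (Rn n \<Otimes>\<^sub>M Rn n) (\<lambda>w. (y w, \<omega> w))"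
    using assms(4) unfolding indep_var_distribution_eq d by simp
  then have "gaussian n (m + m') (s + t)
    = distr (distr P (Rn n \<Otimes>\<^sub>M Rn n) (\<lambda>w. (y w, \<omega> w))) (Rn n) (\<lambda>(x, y). \<lambda>i\<in>{..<n}. x i + y i)"
    using gaussian_add[OF s t m', of m] by simp
  also have "\<dots> = distr P (Rn n) (\<lambda>w. \<lambda>i\<in>{..<n}. y w i + \<omega> w i)"
    by (subst distr_distr) (auto simp: comp_def)
  finally show ?thesis
    using measurable_compose[OF _ plus, of "\<lambda>w. (y w, \<omega> w)" P] by (auto simp: gaussian_rv_def)
qed

section \<open>Chernoff bounds for maxima of Gaussian linear forms\<close>

lemma power4_le_exp: "0 \<le> x \<Longrightarrow> x^4 \<le> 64 * exp x" for x :: real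
proof -
  assume "0 \<le> x"
  then have "1 + x / 2 + (x / 2)\<^sup>2 / 2 \<le> exp (x / 2)"
    by (intro exp_lower_Taylor_quadratic) simp
  with \<open>0 \<le> x\<close> have "x\<^sup>2 / 8 \<le> exp (x / 2)" by (simp add: power_divide)
  then have "(x\<^sup>2 / 8)\<^sup>2 \<le> (exp (x / 2))\<^sup>2" by (intro power_mono) auto
  then show ?thesis by (simp add: power_divide exp_double[symmetric] flip: power_mult)
qed

text \<open>Splits at threshold \<open>l\<close>. Beyond it, with |x| = l + T, the bound (l + T)^4
  \<le> 8 l^4 + 8 T^4 and T^4 \<le> 64 exp (l T) give 512 = 8 * 64. The factor exp (- l^2) is the
  gain: a standard normal form costs only exp (l^2 / 2), which leaves exp (- l^2 / 2) to pay for the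
  number of forms.\<close>

lemma power4_le_cosh:
  fixes x l :: real
  assumes "l \<ge> 1"
  shows "x^4 \<le> 8 * l^4 + 512 * exp (- l\<^sup>2) * (exp (l * x) + exp (- (l * x)))"
proof (cases "\<bar>x\<bar> \<le> l")
  case True
  then have "\<bar>x\<bar>^4 \<le> l^4" by (intro power_mono) auto
  then have "x^4 \<le> l^4" by (simp add: power_even_abs)
  moreover have "0 \<le> l^4" by simp
  moreover have "0 \<le> 512 * exp (- l\<^sup>2) * (exp (l * x) + exp (- (l * x)))"
    by (intro mult_nonneg_nonneg add_nonneg_nonneg) auto
  ultimately show ?thesis by linarith
next
  case False
  define T where "T = \<bar>x\<bar> - l"
  have T: "T > 0" using False by (simp add: T_def)
  have ab: "(a + b)\<^sup>2 \<le> 2 * a\<^sup>2 + 2 * b\<^sup>2" for a b :: real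
    using sum_squares_bound[of a b] by (simp add: power2_sum)
  have "((l + T)\<^sup>2)\<^sup>2 \<le> (2 * l\<^sup>2 + 2 * T\<^sup>2)\<^sup>2" by (intro power_mono ab) auto
  also have "\<dots> \<le> 2 * (2 * l\<^sup>2)\<^sup>2 + 2 * (2 * T\<^sup>2)\<^sup>2" by (rule ab)
  finally have "(l + T)^4 \<le> 8 * l^4 + 8 * T^4" by (simp add: power_mult_distrib flip: power_mult)
  moreover have "(l + T)^4 = x^4" by (simp add: T_def power_even_abs)
  moreover have "T^4 \<le> 64 * exp T" using T by (intro power4_le_exp) simp
  moreover have "exp T \<le> exp (l * T)" using T assms by simp
  moreover have "exp (l * T) = exp (- l\<^sup>2) * exp (l * \<bar>x\<bar>)"
    by (simp add: T_def exp_add[symmetric] algebra_simps power2_eq_square)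
  moreover have "exp (- l\<^sup>2) * exp (l * \<bar>x\<bar>) \<le> exp (- l\<^sup>2) * (exp (l * x) + exp (- (l * x)))"
    by (intro mult_left_mono) (auto simp: abs_if)
  ultimately show ?thesis by linarith
qed

lemma gaussian_exp_linear:
  assumes "t > 0"
  shows "has_bochner_integral (gaussian n m t) (\<lambda>x. exp (\<Sum>i<n. v i * (x i - m $ i)))
    (exp (t / 2 * (\<Sum>i<n. (v i)\<^sup>2)))"
  by (intro has_bochner_integral_nn_integral) (auto simp: gaussian_mgf[OF assms])

text \<open>The maximum of the linear forms is replaced by an explicit measurable majorant:
  a Chernoff bound at the parameter \<open>sqrt (2 (1 + ln N))\<close>, summed over the forms.\<close>

lemma gaussian_linear_forms_fourth_moment:
  fixes m :: "real vec"
  assumes t: "t > 0" and V: "finite V" "\<forall>v\<in>V. (\<Sum>i<n. (v i)\<^sup>2) \<le> 1"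
    and N: "N \<ge> 1" "real (card V) \<le> N"
  shows "\<exists>W. W \<in> borel_measurable (Rn n) \<and> (\<forall>x. \<forall>v\<in>V. (\<Sum>i<n. v i * (x i - m $ i))^4 \<le> W x)
    \<and> integrable (gaussian n m t) W \<and> (\<integral>x. W x \<partial>gaussian n m t) \<le> 1056 * t\<^sup>2 * (1 + ln N)\<^sup>2"
proof -
  interpret prob_space "gaussian n m t" using t by (rule prob_space_gaussian)
  \<comment> \<open>Chosen so that N exp (- l^2 / 2) = exp (- 1), and so that l \<ge> 1 as the
    pointwise bound requires.\<close>
  define l where "l = sqrt (2 * (1 + ln N))"
  have lnN: "0 \<le> ln N" using N by simp
  have l: "l \<ge> 1" and l2: "l\<^sup>2 = 2 * (1 + ln N)"
    using lnN by (simp_all add: l_def)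
  have l4: "l^4 = 4 * (1 + ln N)\<^sup>2"
  proof -
    have "l^4 = (l\<^sup>2)\<^sup>2" by (simp flip: power_mult)
    then show ?thesis unfolding l2 power_mult_distrib by simp
  qed
  define g where "g c v x = exp (\<Sum>i<n. (c * v i) * (x i - m $ i))" for c :: real and v and x :: "nat \<Rightarrow> real"
  \<comment> \<open>The pointwise bound is applied to the standardized form z / sqrt t, which turns
    the exponent l into \<open>c\<close>.\<close>
  define c where "c = l / sqrt t"
  define W where "W x = t\<^sup>2 * (8 * l^4 + 512 * exp (- l\<^sup>2) * (\<Sum>v\<in>V. g c v x + g (- c) v x))" for x
  have g: "has_bochner_integral (gaussian n m t) (g b v) (exp (t / 2 * (b\<^sup>2 * (\<Sum>i<n. (v i)\<^sup>2))))" for b v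
    using gaussian_exp_linear[OF t, of n m "\<lambda>i. b * v i"]
    by (simp add: g_def[abs_def] power_mult_distrib sum_distrib_left)
  have g_nn: "g b v x \<ge> 0" for b v x by (simp add: g_def)
  have meas: "W \<in> borel_measurable (Rn n)" unfolding W_def g_def by measurable
  have bound: "(\<Sum>i<n. v i * (x i - m $ i))^4 \<le> W x" if v: "v \<in> V" for x v
  proof -
    define z where "z = (\<Sum>i<n. v i * (x i - m $ i))"
    have "(z / sqrt t)^4 \<le> 8 * l^4 + 512 * exp (- l\<^sup>2) * (exp (l * (z / sqrt t)) + exp (- (l * (z / sqrt t))))"
      by (rule power4_le_cosh[OF l])
    also have "exp (l * (z / sqrt t)) = g c v x"
      by (simp add: g_def c_def z_def sum_distrib_left sum_divide_distrib mult.assoc)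
    also have "exp (- (l * (z / sqrt t))) = g (- c) v x"
      by (simp add: g_def c_def z_def sum_distrib_left sum_divide_distrib sum_negf mult.assoc)
    also have "g c v x + g (- c) v x \<le> (\<Sum>v\<in>V. g c v x + g (- c) v x)"
      using V(1) v g_nn by (intro member_le_sum) (auto intro: add_nonneg_nonneg)
    finally have "(z / sqrt t)^4 \<le> 8 * l^4 + 512 * exp (- l\<^sup>2) * (\<Sum>v\<in>V. g c v x + g (- c) v x)" by simp
    then have "t\<^sup>2 * (z / sqrt t)^4 \<le> W x" unfolding W_def by (intro mult_left_mono) auto
    moreover have "(sqrt t)^4 = t\<^sup>2"
      using t power_mult[of "sqrt t" 2 2] by simp
    ultimately show ?thesis using t by (simp add: power_divide z_def)
  qed
  have int: "has_bochner_integral (gaussian n m t) W (t\<^sup>2 * (8 * l^4 + 512 * exp (- l\<^sup>2) *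
      (\<Sum>v\<in>V. exp (t / 2 * (c\<^sup>2 * (\<Sum>i<n. (v i)\<^sup>2))) + exp (t / 2 * ((- c)\<^sup>2 * (\<Sum>i<n. (v i)\<^sup>2))))))"
    unfolding W_def
    by (intro has_bochner_integral_mult_right has_bochner_integral_add has_bochner_integral_sum g)
      (simp add: has_bochner_integral_iff prob_space)
  have "exp (t / 2 * (c\<^sup>2 * (\<Sum>i<n. (v i)\<^sup>2))) \<le> exp (l\<^sup>2 / 2)" if "v \<in> V" for v
  proof -
    have "t / 2 * (c\<^sup>2 * (\<Sum>i<n. (v i)\<^sup>2)) = l\<^sup>2 / 2 * (\<Sum>i<n. (v i)\<^sup>2)"
      using t by (simp add: c_def power_divide)
    also have "\<dots> \<le> l\<^sup>2 / 2 * 1" using V(2) that by (intro mult_left_mono) auto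
    finally show ?thesis by simp
  qed
  then have "exp (t / 2 * (c\<^sup>2 * (\<Sum>i<n. (v i)\<^sup>2))) + exp (t / 2 * ((- c)\<^sup>2 * (\<Sum>i<n. (v i)\<^sup>2))) \<le> 2 * exp (l\<^sup>2 / 2)"
    if "v \<in> V" for v
    using that by fastforce
  then have "(\<Sum>v\<in>V. exp (t / 2 * (c\<^sup>2 * (\<Sum>i<n. (v i)\<^sup>2))) + exp (t / 2 * ((- c)\<^sup>2 * (\<Sum>i<n. (v i)\<^sup>2))))
      \<le> (\<Sum>v\<in>V. 2 * exp (l\<^sup>2 / 2))"
    by (rule sum_mono)
  also have "\<dots> \<le> N * (2 * exp (l\<^sup>2 / 2))"
    using N by (simp add: mult_right_mono)
  finally have "512 * exp (- l\<^sup>2) * (\<Sum>v\<in>V. exp (t / 2 * (c\<^sup>2 * (\<Sum>i<n. (v i)\<^sup>2))) + exp (t / 2 * ((- c)\<^sup>2 * (\<Sum>i<n. (v i)\<^sup>2))))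
      \<le> 512 * exp (- l\<^sup>2) * (N * (2 * exp (l\<^sup>2 / 2)))" by (intro mult_left_mono) auto
  also have "\<dots> = 1024 * N * exp (- l\<^sup>2 / 2)"
    by (simp add: exp_add[symmetric])
  also have "\<dots> = 1024 * exp (- 1)"
  proof -
    have "- l\<^sup>2 / 2 = - 1 - ln N" by (simp add: l2)
    then show ?thesis using N by (simp add: exp_diff)
  qed
  also have "\<dots> \<le> 1024 * (1 + ln N)\<^sup>2"
    using lnN one_le_power[of "1 + ln N" 2] exp_le_one_iff[of "-1::real"] by linarith
  finally have "(\<integral>x. W x \<partial>gaussian n m t) \<le> t\<^sup>2 * (8 * l^4 + 1024 * (1 + ln N)\<^sup>2)"
    unfolding has_bochner_integral_integral_eq[OF int] by (intro mult_left_mono add_left_mono) auto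
  \<comment> \<open>1056 = 32 + 1024: the threshold part 8 l^4 is 32 (1 + ln N)^2, and the
    exponential part is at most 1024 = 2 * 512 times (1 + ln N)^2.\<close>
  also have "\<dots> = 1056 * t\<^sup>2 * (1 + ln N)\<^sup>2" by (simp add: l4 algebra_simps)
  finally show ?thesis
    using meas bound int by (intro exI[of _ W]) (auto simp: has_bochner_integral_iff)
qed

section \<open>Completed measures and measurability of the selection\<close>

text \<open>Preimages under \<open>f\<close> and \<open>g\<close> differ only inside a null set, all
  of whose subsets are measurable in the completion.\<close>

lemma borel_measurable_completion_AE:
  assumes g: "g \<in> M \<rightarrow>\<^sub>M N" and ae: "AE x in M. f x = g x" and sp: "f \<in> space M \<rightarrow> space N"
  shows "f \<in> completion M \<rightarrow>\<^sub>M N"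
proof (rule measurableI)
  from ae obtain Z where Z: "{x \<in> space M. f x \<noteq> g x} \<subseteq> Z" "Z \<in> null_sets M"
    unfolding eventually_ae_filter by blast
  have eq: "f x = g x" if "x \<in> space M" "x \<notin> Z" for x
    using Z(1) that by blast
  fix A assume A: "A \<in> sets N"
  have decomp: "f -` A \<inter> space M = (g -` A \<inter> space M - Z) \<union> (f -` A \<inter> space M \<inter> Z)"
  proof -
    have "x \<in> f -` A \<inter> space M \<longleftrightarrow> x \<in> (g -` A \<inter> space M - Z) \<union> (f -` A \<inter> space M \<inter> Z)" for x
      using eq[of x] by (cases "x \<in> space M"; cases "x \<in> Z") simp_all
    then show ?thesis by blast
  qed
  have "g -` A \<inter> space M - Z \<in> sets (completion M)"
    by (intro sets_completionI_sets sets.Diff measurable_sets[OF g A] null_setsD2[OF Z(2)])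
  moreover have "f -` A \<inter> space M \<inter> Z \<in> sets (completion M)"
    by (rule null_sets_completion[OF Z(2)]) (rule Int_lower2)
  ultimately show "f -` A \<inter> space (completion M) \<in> sets (completion M)"
    unfolding space_completion by (subst decomp) (rule sets.Un)
qed (use sp in \<open>simp add: Pi_iff\<close>)

lemma integral_completion_AE:
  fixes f g :: "'a \<Rightarrow> real"
  assumes g: "g \<in> borel_measurable M" and ae: "AE x in M. f x = g x"
  shows "integral\<^sup>L (completion M) f = integral\<^sup>L M g"
    and "integrable (completion M) f \<longleftrightarrow> integrable M g"
proof -
  have f: "f \<in> borel_measurable (completion M)"
    using g ae by (rule borel_measurable_completion_AE) auto
  have gc: "g \<in> borel_measurable (completion M)" using g by (rule measurable_completion)
  have ae': "AE x in completion M. f x = g x" using ae by (rule AE_completion)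
  show "integral\<^sup>L (completion M) f = integral\<^sup>L M g"
    using integral_cong_AE[OF f gc ae'] integral_completion[OF g] by simp
  show "integrable (completion M) f \<longleftrightarrow> integrable M g"
    using integrable_cong_AE[OF f gc ae'] integrable_completion[OF g] by simp
qed

lemma topspace_top_Rn: "topspace (top_Rn n) = space (Rn n)"
  by (auto simp: top_Rn_def space_Rn PiE_def)

text \<open>Restriction to the first n coordinates pulls \<open>S\<close> back to an open set of the
  full function space, whose Borel sets are those of the countable product.\<close>

lemma openin_top_Rn_measurable:
  assumes "openin (top_Rn n) S"
  shows "S \<in> sets (Rn n)"
proof -
  have cont: "continuous_map (product_topology (\<lambda>_. euclideanreal) UNIV) (top_Rn n) (\<lambda>x. restrict x {..<n})"
    unfolding top_Rn_def continuous_map_componentwise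
    by (auto intro: continuous_map_product_projection)
  then have "openin (product_topology (\<lambda>_. euclideanreal) UNIV) {x. restrict x {..<n} \<in> S}"
    using openin_continuous_map_preimage[OF cont assms] by simp
  then have "open {x. restrict x {..<n} \<in> S}"
    by (simp add: open_fun_def)
  then have "{x. restrict x {..<n} \<in> S} \<in> sets (PiM UNIV (\<lambda>_::nat. borel :: real measure))"
    by (simp add: sets_PiM_equal_borel)
  moreover have "(\<lambda>x. x) \<in> Rn n \<rightarrow>\<^sub>M PiM UNIV (\<lambda>_::nat. borel :: real measure)"
  proof (rule measurable_PiM_single')
    fix i :: nat
    show "(\<lambda>x. x i) \<in> borel_measurable (Rn n)"
    proof (cases "i < n")
      case False
      \<comment> \<open>Coordinates beyond n are constant on extensional functions, hence
        measurable.\<close>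
      then have "x i = undefined" if "x \<in> space (Rn n)" for x
        using that by (auto simp: space_Rn extensional_def)
      then show ?thesis
        using measurable_cong[of "Rn n" "\<lambda>x. x i" "\<lambda>_. undefined" borel] by simp
    qed simp
  qed (auto)
  ultimately have "(\<lambda>x. x) -` {x. restrict x {..<n} \<in> S} \<inter> space (Rn n) \<in> sets (Rn n)"
    by (intro measurable_sets)
  moreover have "S \<subseteq> space (Rn n)"
    using openin_subset[OF assms] by (simp add: topspace_top_Rn)
  then have "(\<lambda>x. x) -` {x. restrict x {..<n} \<in> S} \<inter> space (Rn n) = S"
    by (auto simp: space_Rn extensional_restrict dest: subsetD)
  ultimately show ?thesis by simp
qed

text \<open>A region need not be Borel, but its interior is, and the two differ only within the null
  frontier. There are finitely many regions, so the exceptional set is null.\<close>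

lemma selection_map_measurable_version:
  assumes sel: "selection_map n Ms Mhat" and fin: "finite Ms"
  obtains M' Z where "M' \<in> Rn n \<rightarrow>\<^sub>M count_space Ms" "Z \<in> null_sets (Rn n)"
    and "\<And>y. y \<in> space (Rn n) \<Longrightarrow> y \<notin> Z \<Longrightarrow> M' y = Mhat y"
proof -
  define U where "U M = {y \<in> space (Rn n). Mhat y = M}" for M
  define I where "I M = top_Rn n interior_of (U M)" for M
  define Z where "Z = (\<Union>M\<in>Ms. top_Rn n frontier_of (U M))"
  have img: "Mhat ` space (Rn n) = Ms"
    and fr: "\<And>M. M \<in> Ms \<Longrightarrow> top_Rn n frontier_of (U M) \<in> null_sets (Rn n)"
    using sel unfolding selection_map_def Let_def U_def by blast+
  have "(\<lambda>i\<in>{..<n}. 0) \<in> space (Rn n)" by (simp add: space_Rn)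
  then obtain M0 where M0: "M0 \<in> Ms" using img by blast
  have IU: "I M \<subseteq> U M" for M by (simp add: I_def interior_of_subset)
  have I: "I M \<in> sets (Rn n)" for M by (simp add: I_def openin_top_Rn_measurable)
  \<comment> \<open>The default \<open>M0\<close> is used off all the interiors, so it is an
    arbitrary value taken only on the exceptional null set.\<close>
  define M' where "M' y = (if y \<in> (\<Union>M\<in>Ms. I M) then Mhat y else M0)" for y
  have "M' \<in> Rn n \<rightarrow>\<^sub>M count_space Ms"
  proof (subst measurable_count_space_eq2[OF fin], intro conjI ballI)
    show "M' \<in> space (Rn n) \<rightarrow> Ms" using img M0 by (auto simp: M'_def)
    fix M assume M: "M \<in> Ms"
    have "M' -` {M} \<inter> space (Rn n)
      = I M \<union> (if M = M0 then space (Rn n) - (\<Union>M\<in>Ms. I M) else {})"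
    proof (intro equalityI subsetI)
      fix y assume "y \<in> M' -` {M} \<inter> space (Rn n)"
      then have y: "M' y = M" "y \<in> space (Rn n)" by auto
      show "y \<in> I M \<union> (if M = M0 then space (Rn n) - (\<Union>M\<in>Ms. I M) else {})"
      proof (cases "y \<in> (\<Union>M\<in>Ms. I M)")
        case True
        then obtain M2 where M2: "y \<in> I M2" by blast
        then have "Mhat y = M2" using IU[of M2] by (auto simp: U_def)
        then show ?thesis using True y(1) M2 by (simp add: M'_def)
      next
        case False
        then show ?thesis using y by (simp add: M'_def)
      qed
    next
      fix y assume y: "y \<in> I M \<union> (if M = M0 then space (Rn n) - (\<Union>M\<in>Ms. I M) else {})"
      show "y \<in> M' -` {M} \<inter> space (Rn n)"
      proof (cases "y \<in> I M")
        case True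
        then have "y \<in> U M" using IU by blast
        then show ?thesis using True M by (auto simp: M'_def U_def)
      next
        case False
        then have "M = M0" "y \<in> space (Rn n)" "y \<notin> (\<Union>M\<in>Ms. I M)"
          using y by (auto split: if_splits)
        then show ?thesis by (simp add: M'_def)
      qed
    qed
    then show "M' -` {M} \<inter> space (Rn n) \<in> sets (Rn n)"
      using I fin by (simp, intro impI sets.Un sets.Diff sets.finite_UN) auto
  qed
  moreover have "Z \<in> null_sets (Rn n)"
    unfolding Z_def using fin fr by (intro null_sets_UN') (auto intro: countable_finite)
  moreover have "M' y = Mhat y" if y: "y \<in> space (Rn n)" "y \<notin> Z" for y
  proof -
    have M: "Mhat y \<in> Ms" using img y by auto
    \<comment> \<open>Every point is in the closure of its own region; off the frontier it must then
      be in the interior.\<close>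
    have "y \<in> top_Rn n closure_of (U (Mhat y))"
      using y closure_of_subset[of "U (Mhat y)" "top_Rn n"]
      by (auto simp: U_def topspace_top_Rn)
    moreover have "y \<notin> top_Rn n frontier_of (U (Mhat y))" using y M by (auto simp: Z_def)
    ultimately have "y \<in> I (Mhat y)" by (simp add: frontier_of_def I_def)
    then show ?thesis using M by (auto simp: M'_def)
  qed
  ultimately show ?thesis using that by blast
qed

section \<open>Pointwise bound for the deviation of the estimator\<close>

text \<open>The residual vector is r + e - c w - H e. Since H annihilates r, the product of r and H
  e vanishes; since |H e|^2 = e . H e, the terms |H e|^2 - 2 e . H e collapse to - q e e. The scalar
  \<open>c\<close> will be 1 / \<alpha>.\<close>

lemma projection_residual_expansion:
  fixes h :: "nat \<Rightarrow> nat \<Rightarrow> real" and m e w :: "nat \<Rightarrow> real" and c :: real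
  assumes sym: "\<And>a b. a < n \<Longrightarrow> b < n \<Longrightarrow> h a b = h b a"
    and idem: "\<And>a b. a < n \<Longrightarrow> b < n \<Longrightarrow> (\<Sum>c<n. h a c * h c b) = h a b"
  defines "r \<equiv> \<lambda>i. m i - (\<Sum>j<n. h i j * m j)"
    and "q \<equiv> \<lambda>x y. \<Sum>a<n. \<Sum>b<n. x a * h a b * y b"
  shows "(\<Sum>i<n. (m i + e i - c * w i - (\<Sum>j<n. h i j * (m j + e j)))\<^sup>2)
    = (\<Sum>i<n. (e i)\<^sup>2) + c\<^sup>2 * (\<Sum>i<n. (w i)\<^sup>2) - 2 * c * (\<Sum>i<n. e i * w i)
      + (\<Sum>i<n. (r i)\<^sup>2) - q e e + 2 * (\<Sum>i<n. r i * e i)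
      - 2 * c * (\<Sum>i<n. r i * w i) + 2 * c * q e w"
proof -
  define A where "A i = (\<Sum>j<n. h i j * e j)" for i
  have hr: "(\<Sum>i<n. h j i * r i) = 0" if j: "j < n" for j
  proof -
    have "(\<Sum>i<n. h j i * (\<Sum>k<n. h i k * m k)) = (\<Sum>k<n. (\<Sum>i<n. h j i * h i k) * m k)"
      unfolding sum_distrib_left sum_distrib_right by (subst sum.swap) (simp add: mult.assoc)
    also have "\<dots> = (\<Sum>k<n. h j k * m k)"
      using idem[OF j] by (intro sum.cong) auto
    finally show ?thesis by (simp add: r_def right_diff_distrib sum_subtractf)
  qed
  have qA: "(\<Sum>i<n. A i * y i) = q e y" for y
  proof -
    have "(\<Sum>i<n. A i * y i) = (\<Sum>i<n. \<Sum>j<n. e j * h j i * y i)"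
      unfolding A_def sum_distrib_right using sym by (intro sum.cong refl) (simp add: mult_ac)
    also have "\<dots> = q e y" unfolding q_def by (rule sum.swap)
    finally show ?thesis .
  qed
  have rA: "(\<Sum>i<n. r i * A i) = 0"
  proof -
    have "(\<Sum>i<n. r i * A i) = (\<Sum>i<n. \<Sum>j<n. e j * (h j i * r i))"
      unfolding A_def sum_distrib_left using sym by (intro sum.cong refl) (simp add: mult_ac)
    also have "\<dots> = (\<Sum>j<n. \<Sum>i<n. e j * (h j i * r i))" by (rule sum.swap)
    also have "\<dots> = (\<Sum>j<n. e j * (\<Sum>i<n. h j i * r i))" by (simp add: sum_distrib_left)
    finally show ?thesis using hr by simp
  qed
  have AA: "(\<Sum>i<n. A i * A i) = q e e"
  proof -
    have "(\<Sum>i<n. h j i * A i) = A j" if j: "j < n" for j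
    proof -
      have "(\<Sum>i<n. h j i * A i) = (\<Sum>k<n. (\<Sum>i<n. h j i * h i k) * e k)"
        unfolding A_def sum_distrib_left sum_distrib_right by (subst sum.swap) (simp add: mult.assoc)
      also have "\<dots> = A j" unfolding A_def using idem[OF j] by (intro sum.cong) auto
      finally show ?thesis .
    qed
    then have "q e A = (\<Sum>a<n. e a * A a)"
      unfolding q_def by (simp add: mult.assoc sum_distrib_left[symmetric])
    then show ?thesis using qA[of e] qA[of A] by (simp add: mult.commute)
  qed
  have "(m i + e i - c * w i - (\<Sum>j<n. h i j * (m j + e j)))\<^sup>2
    = (e i)\<^sup>2 + c\<^sup>2 * (w i)\<^sup>2 - (2 * c) * (e i * w i) + (r i)\<^sup>2 + A i * A i - 2 * (A i * e i)
      + 2 * (r i * e i) - (2 * c) * (r i * w i) - 2 * (r i * A i) + (2 * c) * (A i * w i)" for i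
  proof -
    have eq: "m i + e i - c * w i - (\<Sum>j<n. h i j * (m j + e j)) = r i + e i - c * w i - A i"
      by (simp add: r_def A_def distrib_left sum.distrib)
    show ?thesis unfolding eq by (simp add: power2_eq_square algebra_simps)
  qed
  then have "(\<Sum>i<n. (m i + e i - c * w i - (\<Sum>j<n. h i j * (m j + e j)))\<^sup>2)
    = (\<Sum>i<n. (e i)\<^sup>2) + c\<^sup>2 * (\<Sum>i<n. (w i)\<^sup>2) - (2 * c) * (\<Sum>i<n. e i * w i) + (\<Sum>i<n. (r i)\<^sup>2)
      + (\<Sum>i<n. A i * A i) - 2 * (\<Sum>i<n. A i * e i) + 2 * (\<Sum>i<n. r i * e i)
      - (2 * c) * (\<Sum>i<n. r i * w i) - 2 * (\<Sum>i<n. r i * A i) + (2 * c) * (\<Sum>i<n. A i * w i)"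
    by (simp only: sum.distrib sum_subtractf sum_distrib_left[symmetric])
  then show ?thesis unfolding AA rA unfolding qA by simp
qed

lemma ErrHat_sum:
  assumes H: "hat_mat X (Mhat (\<lambda>i\<in>{..<n}. y i + \<omega> i)) = H" "H \<in> carrier_mat n n"
  shows "ErrHat n X Mhat \<sigma> \<alpha> y \<omega> = (\<Sum>i<n. (y i - \<omega> i / \<alpha> - (\<Sum>j<n. H $$ (i, j) * y j))\<^sup>2)
    + 2 * tr H * \<sigma>\<^sup>2 - real n * \<sigma>\<^sup>2 / \<alpha>"
  using H(2) unfolding ErrHat_def Let_def H(1)
  by (auto simp: sqnorm_def scalar_prod_def atLeast0LessThan power2_eq_square intro!: sum.cong)

lemma sum_of_nine_squared:
  "(a + b + c + d + e + f + g + h + i)\<^sup>2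
    \<le> 9 * (a\<^sup>2 + b\<^sup>2 + c\<^sup>2 + d\<^sup>2 + e\<^sup>2 + f\<^sup>2 + g\<^sup>2 + h\<^sup>2 + i\<^sup>2)" for a :: real
  using sum_squared_le_sum_of_squares[of "\<lambda>k. [a, b, c, d, e, f, g, h, i] ! k" "{..<9}"]
  by (simp add: eval_nat_numeral lessThan_Suc algebra_simps)

text \<open>Scalar bookkeeping, with \<open>a\<close> for \<alpha> and \<open>s\<close> for
  \<sigma>^2. \<open>Se\<close>, \<open>Sw\<close>, \<open>Ss\<close> are the centered squared norms
  of e, \<omega> and e + \<omega>; \<open>R\<close> is |r|^2; \<open>Q1\<close>, \<open>Q2\<close>,
  \<open>b\<close> are the values of the form of H at (e, e), (\<omega>, \<omega>), (e, \<omega>);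
  \<open>p\<close>, \<open>q\<close> are r . e and r . \<omega>; \<open>T\<close> is the
  trace.\<close>

lemma error_terms_bound:
  fixes a :: real
  assumes a: "0 < a" "a < \<delta>" and T: "0 \<le> T" "T \<le> k"
    and b: "\<bar>2 * b\<bar> \<le> Q1 + Q2" and Q: "Q1\<^sup>2 \<le> k\<^sup>2 * W1" "Q2\<^sup>2 \<le> k\<^sup>2 * W2"
    and pq: "2 * p\<^sup>2 \<le> R\<^sup>2 + W1" "2 * q\<^sup>2 \<le> R\<^sup>2 + W2"
    and D: "D = Se + Sw / a\<^sup>2 - (Ss - Se - Sw) / a + R - Q1 + 2 * p - 2 / a * q + 2 / a * b + 2 * T * s"
  shows "(a * D)\<^sup>2 \<le> 9 * ((1 + \<delta>)\<^sup>2 * Se\<^sup>2 + (1 + \<delta>)\<^sup>2 * (Sw\<^sup>2 / a\<^sup>2) + Ss\<^sup>2 + \<delta>\<^sup>2 * R\<^sup>2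
    + \<delta>\<^sup>2 * (k\<^sup>2 * W1) + 2 * \<delta>\<^sup>2 * (R\<^sup>2 + W1) + 2 * (R\<^sup>2 + W2) + 2 * (k\<^sup>2 * W1 + k\<^sup>2 * W2)
    + 4 * \<delta>\<^sup>2 * (k\<^sup>2 * s\<^sup>2))"
proof -
  \<comment> \<open>\<open>Se\<close> and \<open>Sw\<close> occur both directly and through the
    polarized e . \<omega>, hence the factors 1 + a. \<open>Sw / a\<close> stays unsplit: its size
    is of order sqrt n, because \<omega> has variance proportional to \<alpha>.\<close>
  have aD: "a * D = (1 + a) * Se + (1 + a) * (Sw / a) + (- Ss) + a * R + (- a * Q1) + 2 * a * p
      + (- 2 * q) + 2 * b + 2 * a * T * s"
    using a by (simp add: D field_simps power2_eq_square)
  have a2: "a\<^sup>2 \<le> \<delta>\<^sup>2" and a12: "(1 + a)\<^sup>2 \<le> (1 + \<delta>)\<^sup>2" using a by (auto intro!: power_mono)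
  have 1: "((1 + a) * Se)\<^sup>2 \<le> (1 + \<delta>)\<^sup>2 * Se\<^sup>2"
    unfolding power_mult_distrib by (intro mult_right_mono a12) auto
  have 2: "((1 + a) * (Sw / a))\<^sup>2 \<le> (1 + \<delta>)\<^sup>2 * (Sw\<^sup>2 / a\<^sup>2)"
    unfolding power_mult_distrib power_divide by (intro mult_right_mono a12) auto
  have 3: "(a * R)\<^sup>2 \<le> \<delta>\<^sup>2 * R\<^sup>2"
    unfolding power_mult_distrib by (intro mult_right_mono a2) auto
  have "(- a * Q1)\<^sup>2 = a\<^sup>2 * Q1\<^sup>2" by (simp add: power_mult_distrib)
  also have "\<dots> \<le> \<delta>\<^sup>2 * (k\<^sup>2 * W1)" by (intro mult_mono a2 Q) auto
  finally have 4: "(- a * Q1)\<^sup>2 \<le> \<delta>\<^sup>2 * (k\<^sup>2 * W1)" .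
  have "(2 * a * p)\<^sup>2 = 2 * (a\<^sup>2 * (2 * p\<^sup>2))" by (simp add: power_mult_distrib)
  also have "\<dots> \<le> 2 * (\<delta>\<^sup>2 * (R\<^sup>2 + W1))" by (intro mult_mono a2 pq) auto
  finally have 5: "(2 * a * p)\<^sup>2 \<le> 2 * \<delta>\<^sup>2 * (R\<^sup>2 + W1)" by simp
  have 6: "(- 2 * q)\<^sup>2 \<le> 2 * (R\<^sup>2 + W2)" using pq(2) by (simp add: power_mult_distrib)
  have "(2 * b)\<^sup>2 = \<bar>2 * b\<bar>\<^sup>2" by simp
  also have "\<dots> \<le> (Q1 + Q2)\<^sup>2" by (intro power_mono b) auto
  also have "\<dots> \<le> 2 * (Q1\<^sup>2 + Q2\<^sup>2)" using sum_squares_bound[of Q1 Q2] by (simp add: power2_sum)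
  also have "\<dots> \<le> 2 * (k\<^sup>2 * W1 + k\<^sup>2 * W2)" using Q by simp
  finally have 7: "(2 * b)\<^sup>2 \<le> 2 * (k\<^sup>2 * W1 + k\<^sup>2 * W2)" .
  have "(2 * a * T * s)\<^sup>2 = 4 * (a\<^sup>2 * (T\<^sup>2 * s\<^sup>2))" by (simp add: power_mult_distrib)
  also have "\<dots> \<le> 4 * (\<delta>\<^sup>2 * (k\<^sup>2 * s\<^sup>2))"
    using T by (intro mult_left_mono mult_mono[OF a2] mult_right_mono power_mono) auto
  finally have 8: "(2 * a * T * s)\<^sup>2 \<le> 4 * \<delta>\<^sup>2 * (k\<^sup>2 * s\<^sup>2)" by simp
  show ?thesis
    unfolding aD
    by (rule order_trans[OF sum_of_nine_squared mult_left_mono])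
      (use 1 2 3 4 5 6 7 8 in \<open>auto intro!: add_mono\<close>)
qed

text \<open>A sum of squares is positive semidefinite, so its values at x + y and x - y bound the
  mixed term. The second claim is Cauchy-Schwarz over the k squares, which is where the factor k^2
  enters.\<close>

lemma projection_form_bounds:
  fixes h :: "nat \<Rightarrow> nat \<Rightarrow> real" and u :: "nat \<Rightarrow> nat \<Rightarrow> real"
  assumes sym: "\<And>a b. a < n \<Longrightarrow> b < n \<Longrightarrow> h a b = h b a"
    and u: "\<And>x. (\<Sum>a<n. \<Sum>b<n. x a * h a b * x b) = (\<Sum>j<k. (\<Sum>a<n. u j a * x a)\<^sup>2)"
  defines "q \<equiv> \<lambda>x y. \<Sum>a<n. \<Sum>b<n. x a * h a b * y b"
  shows "\<bar>2 * q x y\<bar> \<le> q x x + q y y"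
    and "(\<And>j. j < k \<Longrightarrow> (\<Sum>a<n. u j a * x a)^4 \<le> W) \<Longrightarrow> (q x x)\<^sup>2 \<le> (real k)\<^sup>2 * W"
proof -
  have nn: "0 \<le> q z z" for z unfolding q_def u by (intro sum_nonneg) auto
  have "q y x = q x y"
    unfolding q_def by (subst sum.swap) (intro sum.cong refl, simp add: sym mult_ac)
  moreover have "q (\<lambda>i. x i + c * y i) (\<lambda>i. x i + c * y i) = q x x + c * q x y + c * q y x + c\<^sup>2 * q y y" for c
    unfolding q_def sum_distrib_left sum.distrib[symmetric]
    by (intro sum.cong refl) (simp add: algebra_simps power2_eq_square)
  ultimately have "0 \<le> q x x + 2 * c * q x y + c\<^sup>2 * q y y" for c
    using nn[of "\<lambda>i. x i + c * y i"] by simp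
  from this[of 1] this[of "-1"] show "\<bar>2 * q x y\<bar> \<le> q x x + q y y" by (simp add: abs_if)
  assume W: "\<And>j. j < k \<Longrightarrow> (\<Sum>a<n. u j a * x a)^4 \<le> W"
  have "(q x x)\<^sup>2 \<le> (\<Sum>j<k. ((\<Sum>a<n. u j a * x a)\<^sup>2)\<^sup>2) * real k"
    unfolding q_def u using sum_squared_le_sum_of_squares[of "\<lambda>j. (\<Sum>a<n. u j a * x a)\<^sup>2" "{..<k}"] by simp
  also have "\<dots> \<le> (\<Sum>j<k. W) * real k"
    using W by (intro mult_right_mono sum_mono) (auto simp flip: power_mult)
  finally show "(q x x)\<^sup>2 \<le> (real k)\<^sup>2 * W" by (simp add: power2_eq_square mult_ac)
qed

lemma gaussian_rv_has_bochner_integral: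
  fixes f :: "(nat \<Rightarrow> real) \<Rightarrow> real"
  assumes "gaussian_rv P n m t Y" "f \<in> borel_measurable (Rn n)"
    and "has_bochner_integral (gaussian n m t) f I"
  shows "has_bochner_integral P (\<lambda>w. f (Y w)) I"
proof -
  have Y: "Y \<in> P \<rightarrow>\<^sub>M Rn n" and d: "distr P (Rn n) Y = gaussian n m t"
    using assms(1) by (auto simp: gaussian_rv_def)
  show ?thesis
    using assms(3) integral_distr[OF Y assms(2)] integrable_distr_eq[OF Y assms(2)]
    by (simp add: d has_bochner_integral_iff)
qed

lemma gaussian_rv_AE:
  assumes "gaussian_rv P n m t Y" "t > 0" "Z \<in> null_sets (Rn n)"
  shows "AE w in P. Y w \<notin> Z"
proof -
  have Y: "Y \<in> P \<rightarrow>\<^sub>M Rn n" and d: "distr P (Rn n) Y = gaussian n m t"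
    using assms(1) by (auto simp: gaussian_rv_def)
  have "AE x in distr P (Rn n) Y. x \<notin> Z"
    unfolding d by (rule AE_not_in[OF null_sets_gaussian[OF assms(2,3)]])
  then show ?thesis using AE_distrD[OF Y] by blast
qed

text \<open>Allows centering at the convenient value \<sigma>^2, so that the mean of the estimator
  never has to be computed.\<close>

lemma (in prob_space) variance_le_second_moment:
  fixes Y :: "'a \<Rightarrow> real"
  assumes "integrable M Y" "integrable M (\<lambda>x. (Y x)\<^sup>2)"
  shows "variance Y \<le> expectation (\<lambda>x. (Y x - c)\<^sup>2)"
proof -
  have "expectation (\<lambda>x. (Y x - c)\<^sup>2) = expectation (\<lambda>x. (Y x)\<^sup>2) - 2 * c * expectation Y + c\<^sup>2"
    using assms by (simp add: power2_diff prob_space algebra_simps)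
  moreover have "0 \<le> (expectation Y - c)\<^sup>2" by simp
  ultimately show ?thesis
    using variance_eq[OF assms] by (simp add: power2_diff algebra_simps)
qed

lemma residual_sqnorm:
  assumes "H \<in> carrier_mat n n" "\<mu> \<in> carrier_vec n"
  shows "sqnorm (\<mu> - H *\<^sub>v \<mu>) = (\<Sum>i<n. (\<mu> $ i - (\<Sum>j<n. H $$ (i, j) * \<mu> $ j))\<^sup>2)"
  using assms by (auto simp: sqnorm_def scalar_prod_def atLeast0LessThan power2_eq_square intro!: sum.cong)

lemma hat_mat_entries:
  assumes X: "X \<in> carrier_mat n p" and M: "M \<subseteq> {..<p}"
    and inv: "invertible_mat ((sel_cols X M)\<^sup>T * sel_cols X M)"
  defines "h \<equiv> \<lambda>i j. hat_mat X M $$ (i, j)"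
  shows "\<And>a b. a < n \<Longrightarrow> b < n \<Longrightarrow> h a b = h b a"
    and "\<And>a b. a < n \<Longrightarrow> b < n \<Longrightarrow> (\<Sum>c<n. h a c * h c b) = h a b"
    and "(\<Sum>a<n. h a a) = real (card M)"
proof -
  note H = hat_mat_properties[OF X M inv]
  show "h a b = h b a" if "a < n" "b < n" for a b
    using index_transpose_mat(1)[of b "hat_mat X M" a] H(1,2) that unfolding h_def by simp
  show "(\<Sum>c<n. h a c * h c b) = h a b" if "a < n" "b < n" for a b
    using index_mult_mat(1)[of a "hat_mat X M" b "hat_mat X M"] H(1,3) that
    unfolding h_def by (simp add: scalar_prod_def atLeast0LessThan)
  show "(\<Sum>a<n. h a a) = real (card M)"
    using H(1,4) unfolding h_def tr_def by simp
qed

text \<open>Purely pointwise in \<open>y\<close> and \<open>\<omega>\<close>: \<open>M\<close> is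
  the model selected there, and \<open>W1\<close>, \<open>W2\<close> are the values of the two
  majorants. The right side refers to \<open>M\<close> only through \<open>R\<close>, so it can be
  integrated term by term.\<close>

lemma ErrHat_deviation_bound:
  fixes \<sigma> \<delta> \<alpha> W1 W2 :: real and v :: "nat \<Rightarrow> real" and u :: "nat \<Rightarrow> nat \<Rightarrow> real"
  assumes \<alpha>: "0 < \<alpha>" "\<alpha> < \<delta>" and X: "X \<in> carrier_mat n p" and M: "M \<subseteq> {..<p}"
    and inv: "invertible_mat ((sel_cols X M)\<^sup>T * sel_cols X M)"
    and \<mu>: "\<mu> \<in> carrier_vec n" and k: "card M \<le> k"
    and sel: "Mhat (\<lambda>i\<in>{..<n}. y i + \<omega> i) = M"
    and u: "\<And>x. (\<Sum>a<n. \<Sum>b<n. x a * hat_mat X M $$ (a, b) * x b) = (\<Sum>j<card M. (\<Sum>a<n. u j a * x a)\<^sup>2)"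
    and v: "\<And>i. i < n \<Longrightarrow> \<mu> $ i - (\<Sum>j<n. hat_mat X M $$ (i, j) * \<mu> $ j) = sqrt (sqnorm (\<mu> - hat_mat X M *\<^sub>v \<mu>)) * v i"
    and W1: "\<And>z. z \<in> insert v (u ` {..<card M}) \<Longrightarrow> (\<Sum>i<n. z i * (y i - \<mu> $ i))^4 \<le> W1"
    and W2: "\<And>z. z \<in> insert v (u ` {..<card M}) \<Longrightarrow> (\<Sum>i<n. z i * \<omega> i)^4 \<le> W2"
  defines "R \<equiv> sqnorm (\<mu> - hat_mat X M *\<^sub>v \<mu>)"
  shows "(\<alpha> * (ErrHat n X Mhat \<sigma> \<alpha> y \<omega> - real n * \<sigma>\<^sup>2))\<^sup>2 \<le>
    9 * ((1 + \<delta>)\<^sup>2 * ((\<Sum>i<n. (y i - \<mu> $ i)\<^sup>2) - real n * \<sigma>\<^sup>2)\<^sup>2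
    + (1 + \<delta>)\<^sup>2 * (((\<Sum>i<n. (\<omega> i)\<^sup>2) - real n * (\<alpha> * \<sigma>\<^sup>2))\<^sup>2 / \<alpha>\<^sup>2)
    + ((\<Sum>i<n. (y i + \<omega> i - \<mu> $ i)\<^sup>2) - real n * (\<sigma>\<^sup>2 + \<alpha> * \<sigma>\<^sup>2))\<^sup>2 + \<delta>\<^sup>2 * R\<^sup>2
    + \<delta>\<^sup>2 * ((real k)\<^sup>2 * W1) + 2 * \<delta>\<^sup>2 * (R\<^sup>2 + W1) + 2 * (R\<^sup>2 + W2)
    + 2 * ((real k)\<^sup>2 * W1 + (real k)\<^sup>2 * W2) + 4 * \<delta>\<^sup>2 * ((real k)\<^sup>2 * (\<sigma>\<^sup>2)\<^sup>2))"
proof -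
  define h where "h i j = hat_mat X M $$ (i, j)" for i j
  define e where "e i = y i - \<mu> $ i" for i
  define r where "r i = \<mu> $ i - (\<Sum>j<n. h i j * \<mu> $ j)" for i
  define q where "q x z = (\<Sum>a<n. \<Sum>b<n. x a * h a b * z b)" for x z
  note H = hat_mat_properties[OF X M inv]
  note h = hat_mat_entries[OF X M inv, folded h_def]
  note form = projection_form_bounds[where n = n and h = h and k = "card M" and u = u, OF h(1) u[folded h_def], folded q_def]
  have R: "R = (\<Sum>i<n. (r i)\<^sup>2)"
    unfolding R_def r_def h_def by (rule residual_sqnorm[OF H(1) \<mu>])
  have R0: "0 \<le> R" unfolding R by (intro sum_nonneg) auto
  have rv: "r i = sqrt R * v i" if "i < n" for i
    using v[OF that] by (simp add: r_def h_def R_def)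
  have W0: "0 \<le> W1" "0 \<le> W2"
    using order_trans[OF _ W1[of v]] order_trans[OF _ W2[of v]] by auto
  have kk: "(real (card M))\<^sup>2 \<le> (real k)\<^sup>2" using k by (intro power_mono) auto
  have Q1: "(q e e)\<^sup>2 \<le> (real k)\<^sup>2 * W1"
    using form(2)[of e W1] W1 mult_right_mono[OF kk W0(1)] by (fastforce simp: e_def)
  have Q2: "(q \<omega> \<omega>)\<^sup>2 \<le> (real k)\<^sup>2 * W2"
    using form(2)[of \<omega> W2] W2 mult_right_mono[OF kk W0(2)] by fastforce
  \<comment> \<open>Factoring out sqrt R and using 2 a b \<le> a^2 + b^2 separates the residual from
    the linear form, which are dependent through the selection.\<close>
  have lin: "2 * (\<Sum>i<n. r i * x i)\<^sup>2 \<le> R\<^sup>2 + W" if "(\<Sum>i<n. v i * x i)^4 \<le> W" for x W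
  proof -
    have "(\<Sum>i<n. r i * x i) = sqrt R * (\<Sum>i<n. v i * x i)"
      unfolding sum_distrib_left by (intro sum.cong) (auto simp: rv)
    then have "2 * (\<Sum>i<n. r i * x i)\<^sup>2 = 2 * R * (\<Sum>i<n. v i * x i)\<^sup>2"
      using R0 by (simp add: power_mult_distrib)
    also have "\<dots> \<le> R\<^sup>2 + ((\<Sum>i<n. v i * x i)\<^sup>2)\<^sup>2" by (rule sum_squares_bound)
    finally show ?thesis using that by (simp flip: power_mult)
  qed
  have "ErrHat n X Mhat \<sigma> \<alpha> y \<omega>
    = (\<Sum>i<n. (y i - \<omega> i / \<alpha> - (\<Sum>j<n. h i j * y j))\<^sup>2) + 2 * real (card M) * \<sigma>\<^sup>2 - real n * \<sigma>\<^sup>2 / \<alpha>"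
    using ErrHat_sum[where X = X and Mhat = Mhat and y = y and n = n and \<omega> = \<omega> and H = "hat_mat X M" and \<sigma> = \<sigma> and \<alpha> = \<alpha>] H(1,4) sel by (simp add: h_def)
  also have "(\<Sum>i<n. (y i - \<omega> i / \<alpha> - (\<Sum>j<n. h i j * y j))\<^sup>2)
    = (\<Sum>i<n. (\<mu> $ i + e i - (1 / \<alpha>) * \<omega> i - (\<Sum>j<n. h i j * (\<mu> $ j + e j)))\<^sup>2)"
    by (simp add: e_def)
  also have "\<dots> = (\<Sum>i<n. (e i)\<^sup>2) + (1 / \<alpha>)\<^sup>2 * (\<Sum>i<n. (\<omega> i)\<^sup>2) - 2 * (1 / \<alpha>) * (\<Sum>i<n. e i * \<omega> i)
      + R - q e e + 2 * (\<Sum>i<n. r i * e i) - 2 * (1 / \<alpha>) * (\<Sum>i<n. r i * \<omega> i) + 2 * (1 / \<alpha>) * q e \<omega>"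
    unfolding R r_def q_def by (rule projection_residual_expansion[OF h(1,2)])
  finally have E: "ErrHat n X Mhat \<sigma> \<alpha> y \<omega> = (\<Sum>i<n. (e i)\<^sup>2) + (1 / \<alpha>)\<^sup>2 * (\<Sum>i<n. (\<omega> i)\<^sup>2)
      - 2 * (1 / \<alpha>) * (\<Sum>i<n. e i * \<omega> i)
      + R - q e e + 2 * (\<Sum>i<n. r i * e i) - 2 * (1 / \<alpha>) * (\<Sum>i<n. r i * \<omega> i) + 2 * (1 / \<alpha>) * q e \<omega>
      + 2 * real (card M) * \<sigma>\<^sup>2 - real n * \<sigma>\<^sup>2 / \<alpha>" .
  have "(\<Sum>i<n. (y i + \<omega> i - \<mu> $ i)\<^sup>2) = (\<Sum>i<n. (e i)\<^sup>2 + 2 * (e i * \<omega> i) + (\<omega> i)\<^sup>2)"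
    by (intro sum.cong refl) (simp add: e_def power2_eq_square algebra_simps)
  then have pol: "2 * (\<Sum>i<n. e i * \<omega> i)
    = (\<Sum>i<n. (y i + \<omega> i - \<mu> $ i)\<^sup>2) - (\<Sum>i<n. (e i)\<^sup>2) - (\<Sum>i<n. (\<omega> i)\<^sup>2)"
    by (simp add: sum.distrib sum_distrib_left)
  show ?thesis
  proof (rule error_terms_bound[OF \<alpha> _ _ form(1)[of e \<omega>] Q1 Q2 lin lin])
    show "ErrHat n X Mhat \<sigma> \<alpha> y \<omega> - real n * \<sigma>\<^sup>2
      = ((\<Sum>i<n. (y i - \<mu> $ i)\<^sup>2) - real n * \<sigma>\<^sup>2)
      + ((\<Sum>i<n. (\<omega> i)\<^sup>2) - real n * (\<alpha> * \<sigma>\<^sup>2)) / \<alpha>\<^sup>2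
      - (((\<Sum>i<n. (y i + \<omega> i - \<mu> $ i)\<^sup>2) - real n * (\<sigma>\<^sup>2 + \<alpha> * \<sigma>\<^sup>2))
         - ((\<Sum>i<n. (y i - \<mu> $ i)\<^sup>2) - real n * \<sigma>\<^sup>2)
         - ((\<Sum>i<n. (\<omega> i)\<^sup>2) - real n * (\<alpha> * \<sigma>\<^sup>2))) / \<alpha>
      + R - q e e + 2 * (\<Sum>i<n. r i * e i) - 2 / \<alpha> * (\<Sum>i<n. r i * \<omega> i) + 2 / \<alpha> * q e \<omega>
      + 2 * real (card M) * \<sigma>\<^sup>2"
    proof -
      have "2 * (1 / \<alpha>) * (\<Sum>i<n. e i * \<omega> i) = ((\<Sum>i<n. (y i + \<omega> i - \<mu> $ i)\<^sup>2) - (\<Sum>i<n. (e i)\<^sup>2) - (\<Sum>i<n. (\<omega> i)\<^sup>2)) / \<alpha>"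
        using pol by simp
      \<comment> \<open>The centering constants balance: n \<alpha> \<sigma>^2 / \<alpha>^2 is the
        correction n \<sigma>^2 / \<alpha>, and those of the three polarized norms add up to
        zero.\<close>
      moreover have "A + (1 / \<alpha>)\<^sup>2 * B - (C - A - B) / \<alpha> + R - q e e + 2 * f - 2 * (1 / \<alpha>) * g
          + 2 * (1 / \<alpha>) * q e \<omega> + d - real n * \<sigma>\<^sup>2 / \<alpha> - real n * \<sigma>\<^sup>2
        = (A - real n * \<sigma>\<^sup>2) + (B - real n * (\<alpha> * \<sigma>\<^sup>2)) / \<alpha>\<^sup>2
          - ((C - real n * (\<sigma>\<^sup>2 + \<alpha> * \<sigma>\<^sup>2)) - (A - real n * \<sigma>\<^sup>2) - (B - real n * (\<alpha> * \<sigma>\<^sup>2))) / \<alpha>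
          + R - q e e + 2 * f - 2 / \<alpha> * g + 2 / \<alpha> * q e \<omega> + d" for A B C d f g
        using \<alpha> by (simp add: field_simps power2_eq_square)
      ultimately show ?thesis unfolding E e_def[symmetric] by (simp only:)
    qed
    show "(\<Sum>i<n. v i * e i)^4 \<le> W1" using W1 by (simp add: e_def)
    show "(\<Sum>i<n. v i * \<omega> i)^4 \<le> W2" using W2 by simp
  qed (use k in auto)
qed

section \<open>The variance bound\<close>

text \<open>For a fixed model the estimator is a polynomial in the coordinates, and a measurable
  choice among finitely many models preserves measurability.\<close>

lemma borel_measurable_ErrHat:
  assumes M': "M' \<in> Rn n \<rightarrow>\<^sub>M count_space Ms" and fin: "finite Ms"
    and H: "\<And>M. M \<in> Ms \<Longrightarrow> hat_mat X M \<in> carrier_mat n n"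
    and y[measurable]: "y \<in> P \<rightarrow>\<^sub>M Rn n" and \<omega>[measurable]: "\<omega> \<in> P \<rightarrow>\<^sub>M Rn n"
  shows "(\<lambda>w. ErrHat n X M' \<sigma> \<alpha> (y w) (\<omega> w)) \<in> borel_measurable P"
proof -
  have [measurable]: "(\<lambda>w. \<lambda>i\<in>{..<n}. y w i + \<omega> w i) \<in> P \<rightarrow>\<^sub>M Rn n"
    unfolding Rn_def[of n] using y[unfolded Rn_def] \<omega>[unfolded Rn_def] by measurable
  have g: "(\<lambda>w. M' (\<lambda>i\<in>{..<n}. y w i + \<omega> w i)) \<in> P \<rightarrow>\<^sub>M count_space Ms"
    by (rule measurable_compose[OF _ M']) measurable
  have [measurable]: "i < n \<Longrightarrow> (\<lambda>w. y w i) \<in> borel_measurable P" "i < n \<Longrightarrow> (\<lambda>w. \<omega> w i) \<in> borel_measurable P" for i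
    using measurable_compose[OF y measurable_Rn_component] measurable_compose[OF \<omega> measurable_Rn_component] by auto
  define F where "F M w = (\<Sum>i<n. (y w i - \<omega> w i / \<alpha> - (\<Sum>j<n. hat_mat X M $$ (i, j) * y w j))\<^sup>2)
    + 2 * tr (hat_mat X M) * \<sigma>\<^sup>2 - real n * \<sigma>\<^sup>2 / \<alpha>" for M w
  have "(\<lambda>w. F (M' (\<lambda>i\<in>{..<n}. y w i + \<omega> w i)) w) \<in> borel_measurable P"
  proof (rule measurable_compose_countable'[OF _ g])
    show "F M \<in> borel_measurable P" for M unfolding F_def by measurable
  qed (use fin in \<open>simp add: countable_finite\<close>)
  moreover have "ErrHat n X M' \<sigma> \<alpha> (y w) (\<omega> w) = F (M' (\<lambda>i\<in>{..<n}. y w i + \<omega> w i)) w" if "w \<in> space P" for w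
    unfolding F_def using H measurable_space[OF g that] by (intro ErrHat_sum) auto
  ultimately show ?thesis by (subst measurable_cong) auto
qed

text \<open>Mirrors the nine terms of \<open>error_terms_bound\<close> after division by n. The
  three squared norms contribute 2 each to the 6; \<open>B\<close> comes from the accuracy
  condition, \<open>C0\<close> from the model sizes, and \<open>J\<close> n bounds the expectation
  of (k^2 or 1) times \<open>W1\<close>.\<close>

definition variance_const :: "real \<Rightarrow> real \<Rightarrow> real \<Rightarrow> real \<Rightarrow> real" where
  "variance_const \<sigma> \<delta> B C0 = (let J = 1056 * (\<sigma>\<^sup>2)\<^sup>2 * C0 in
     9 * (6 * (1 + \<delta>)\<^sup>2 * (\<sigma>\<^sup>2)\<^sup>2 + \<delta>\<^sup>2 * B + \<delta>\<^sup>2 * J + 2 * \<delta>\<^sup>2 * (B + J) + 2 * (B + \<delta>\<^sup>2 * J)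
       + 2 * (J + \<delta>\<^sup>2 * J) + 4 * \<delta>\<^sup>2 * (C0 * (\<sigma>\<^sup>2)\<^sup>2)))"

text \<open>Here \<open>c\<close> is n and \<open>L\<close> is 1 + ln of the number of directions.
  The single bound on (1 + k)^2 L^2 controls k^2 L^2, L^2 and k^2 separately, and the \<alpha>^2 in
  \<open>I2\<close> is absorbed into \<delta>^2.\<close>

lemma expected_bound_le_variance_const:
  fixes \<alpha> \<delta> \<sigma> k L c :: real
  assumes \<alpha>: "0 < \<alpha>" "\<alpha> < \<delta>" and c: "(1 + k)\<^sup>2 * L\<^sup>2 \<le> C0 * c" "0 \<le> k" "1 \<le> L" "0 \<le> c"
    and IR: "IR \<le> B * c" and I1: "I1 \<le> 1056 * (\<sigma>\<^sup>2)\<^sup>2 * L\<^sup>2" and I2: "I2 \<le> 1056 * (\<alpha> * \<sigma>\<^sup>2)\<^sup>2 * L\<^sup>2"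
  shows "9 * ((1 + \<delta>)\<^sup>2 * (2 * c * (\<sigma>\<^sup>2)\<^sup>2) + (1 + \<delta>)\<^sup>2 * (2 * c * (\<alpha> * \<sigma>\<^sup>2)\<^sup>2 / \<alpha>\<^sup>2)
    + 2 * c * (\<sigma>\<^sup>2 + \<alpha> * \<sigma>\<^sup>2)\<^sup>2 + \<delta>\<^sup>2 * IR
    + \<delta>\<^sup>2 * (k\<^sup>2 * I1) + 2 * \<delta>\<^sup>2 * (IR + I1) + 2 * (IR + I2)
    + 2 * (k\<^sup>2 * I1 + k\<^sup>2 * I2) + 4 * \<delta>\<^sup>2 * (k\<^sup>2 * (\<sigma>\<^sup>2)\<^sup>2)) \<le> variance_const \<sigma> \<delta> B C0 * c"
proof -
  define J where "J = 1056 * (\<sigma>\<^sup>2)\<^sup>2 * C0"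
  have L: "1 \<le> L\<^sup>2" using c(3) by (simp add: one_le_power)
  have k1: "1 \<le> (1 + k)\<^sup>2" "k\<^sup>2 \<le> (1 + k)\<^sup>2" using c(2) by (auto intro!: power_mono one_le_power)
  have "k\<^sup>2 * L\<^sup>2 \<le> (1 + k)\<^sup>2 * L\<^sup>2" using k1 by (intro mult_right_mono) auto
  with c(1) have kL: "k\<^sup>2 * L\<^sup>2 \<le> C0 * c" by linarith
  have "1 * L\<^sup>2 \<le> (1 + k)\<^sup>2 * L\<^sup>2" using k1 by (intro mult_right_mono) auto
  with c(1) have LL: "L\<^sup>2 \<le> C0 * c" by linarith
  have "k\<^sup>2 * 1 \<le> k\<^sup>2 * L\<^sup>2" using L by (intro mult_left_mono) auto
  with kL have kC: "k\<^sup>2 \<le> C0 * c" by linarith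
  have a2: "\<alpha>\<^sup>2 \<le> \<delta>\<^sup>2" and a1: "(1 + \<alpha>)\<^sup>2 \<le> (1 + \<delta>)\<^sup>2" using \<alpha> by (auto intro!: power_mono)
  have scale: "1056 * (\<sigma>\<^sup>2)\<^sup>2 * z \<le> J * c" if "z \<le> C0 * c" for z
    using mult_left_mono[OF that, of "1056 * (\<sigma>\<^sup>2)\<^sup>2"] by (simp add: J_def mult_ac)
  have J1: "I1 \<le> J * c" using I1 scale[OF LL] by linarith
  have "k\<^sup>2 * I1 \<le> k\<^sup>2 * (1056 * (\<sigma>\<^sup>2)\<^sup>2 * L\<^sup>2)" using I1 by (intro mult_left_mono) auto
  then have J2: "k\<^sup>2 * I1 \<le> J * c" using scale[OF kL] by (simp add: mult_ac)
  have scale2: "1056 * (\<alpha> * \<sigma>\<^sup>2)\<^sup>2 * z \<le> \<delta>\<^sup>2 * (J * c)" if "z \<le> C0 * c" "0 \<le> z" for z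
  proof -
    have "1056 * (\<alpha> * \<sigma>\<^sup>2)\<^sup>2 * z = \<alpha>\<^sup>2 * (1056 * (\<sigma>\<^sup>2)\<^sup>2 * z)" by (simp add: power_mult_distrib)
    also have "\<dots> \<le> \<delta>\<^sup>2 * (J * c)" using that(2) by (intro mult_mono a2 scale that(1)) auto
    finally show ?thesis .
  qed
  have J3: "I2 \<le> \<delta>\<^sup>2 * (J * c)" using order_trans[OF I2 scale2[OF LL]] by simp
  have "k\<^sup>2 * I2 \<le> k\<^sup>2 * (1056 * (\<alpha> * \<sigma>\<^sup>2)\<^sup>2 * L\<^sup>2)" using I2 by (intro mult_left_mono) auto
  then have J4: "k\<^sup>2 * I2 \<le> \<delta>\<^sup>2 * (J * c)" using scale2[OF kL] by (simp add: mult_ac)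
  have "(\<sigma>\<^sup>2 + \<alpha> * \<sigma>\<^sup>2)\<^sup>2 = (1 + \<alpha>)\<^sup>2 * (\<sigma>\<^sup>2)\<^sup>2" by (simp add: power2_eq_square algebra_simps)
  also have "\<dots> \<le> (1 + \<delta>)\<^sup>2 * (\<sigma>\<^sup>2)\<^sup>2" using a1 by (intro mult_right_mono) auto
  finally have S: "2 * c * (\<sigma>\<^sup>2 + \<alpha> * \<sigma>\<^sup>2)\<^sup>2 \<le> 2 * c * ((1 + \<delta>)\<^sup>2 * (\<sigma>\<^sup>2)\<^sup>2)"
    using c(4) by (intro mult_left_mono) auto
  have S2: "(1 + \<delta>)\<^sup>2 * (2 * c * (\<alpha> * \<sigma>\<^sup>2)\<^sup>2 / \<alpha>\<^sup>2) = (1 + \<delta>)\<^sup>2 * (2 * c * (\<sigma>\<^sup>2)\<^sup>2)"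
    using \<alpha> by (simp add: power_mult_distrib)
  have d2: "0 \<le> \<delta>\<^sup>2" by simp
  have T: "4 * \<delta>\<^sup>2 * (k\<^sup>2 * (\<sigma>\<^sup>2)\<^sup>2) \<le> 4 * \<delta>\<^sup>2 * ((C0 * c) * (\<sigma>\<^sup>2)\<^sup>2)"
    using kC by (intro mult_left_mono mult_right_mono) auto
  have "9 * ((1 + \<delta>)\<^sup>2 * (2 * c * (\<sigma>\<^sup>2)\<^sup>2) + (1 + \<delta>)\<^sup>2 * (2 * c * (\<alpha> * \<sigma>\<^sup>2)\<^sup>2 / \<alpha>\<^sup>2)
    + 2 * c * (\<sigma>\<^sup>2 + \<alpha> * \<sigma>\<^sup>2)\<^sup>2 + \<delta>\<^sup>2 * IR
    + \<delta>\<^sup>2 * (k\<^sup>2 * I1) + 2 * \<delta>\<^sup>2 * (IR + I1) + 2 * (IR + I2)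
    + 2 * (k\<^sup>2 * I1 + k\<^sup>2 * I2) + 4 * \<delta>\<^sup>2 * (k\<^sup>2 * (\<sigma>\<^sup>2)\<^sup>2))
    \<le> 9 * ((1 + \<delta>)\<^sup>2 * (2 * c * (\<sigma>\<^sup>2)\<^sup>2) + (1 + \<delta>)\<^sup>2 * (2 * c * (\<sigma>\<^sup>2)\<^sup>2)
    + 2 * c * ((1 + \<delta>)\<^sup>2 * (\<sigma>\<^sup>2)\<^sup>2) + \<delta>\<^sup>2 * (B * c)
    + \<delta>\<^sup>2 * (J * c) + 2 * \<delta>\<^sup>2 * (B * c + J * c) + 2 * (B * c + \<delta>\<^sup>2 * (J * c))
    + 2 * (J * c + \<delta>\<^sup>2 * (J * c)) + 4 * \<delta>\<^sup>2 * ((C0 * c) * (\<sigma>\<^sup>2)\<^sup>2))"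
    unfolding S2 by (intro mult_left_mono add_mono J1 J2 J3 J4 IR S T order_refl) auto
  also have "\<dots> = variance_const \<sigma> \<delta> B C0 * c"
    unfolding variance_const_def Let_def J_def[symmetric] by (simp add: algebra_simps)
  finally show ?thesis .
qed

text \<open>Each model contributes its rank-one directions and its normalized residual, at most k +
  1 vectors. The family depends on X and \<mu> only, not on the data, so the moment bound for
  finitely many forms applies to it.\<close>

lemma model_directions:
  assumes X: "X \<in> carrier_mat n p" and \<mu>: "\<mu> \<in> carrier_vec n" and fin: "finite Ms"
    and models: "\<forall>M\<in>Ms. M \<subseteq> {..<p} \<and> card M \<le> k \<and> invertible_mat ((sel_cols X M)\<^sup>T * sel_cols X M)"
  shows "\<exists>V u v. finite V \<and> card V \<le> card Ms * (k + 1) \<and> (\<forall>z\<in>V. (\<Sum>i<n. (z i)\<^sup>2) \<le> (1::real))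
    \<and> (\<forall>M\<in>Ms. insert (v M) (u M ` {..<card M}) \<subseteq> V
      \<and> (\<forall>x. (\<Sum>a<n. \<Sum>b<n. x a * hat_mat X M $$ (a, b) * x b)
          = (\<Sum>j<card M. (\<Sum>a<n. u M j a * x a)\<^sup>2))
      \<and> (\<forall>i<n. \<mu> $ i - (\<Sum>j<n. hat_mat X M $$ (i, j) * \<mu> $ j)
          = sqrt (sqnorm (\<mu> - hat_mat X M *\<^sub>v \<mu>)) * v M i))"
proof -
  have Ms: "\<And>M. M \<in> Ms \<Longrightarrow> M \<subseteq> {..<p}" "\<And>M. M \<in> Ms \<Longrightarrow> card M \<le> k"
    "\<And>M. M \<in> Ms \<Longrightarrow> invertible_mat ((sel_cols X M)\<^sup>T * sel_cols X M)"
    using models by auto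
  define Q where "Q M u \<longleftrightarrow> (\<forall>j<card M. (\<Sum>a<n. (u j a)\<^sup>2) = 1) \<and>
    (\<forall>x. (\<Sum>a<n. \<Sum>b<n. x a * hat_mat X M $$ (a, b) * x b) = (\<Sum>j<card M. (\<Sum>a<n. u j a * x a)\<^sup>2))"
    for M and u :: "nat \<Rightarrow> nat \<Rightarrow> real"
  have "\<exists>u. Q M u" if "M \<in> Ms" for M
    unfolding Q_def
    using projection_rank_one_decomposition[OF hat_mat_entries[OF X Ms(1)[OF that] Ms(3)[OF that]]] .
  then obtain u where u: "\<And>M. M \<in> Ms \<Longrightarrow> Q M (u M)" by metis
  define r where "r M i = \<mu> $ i - (\<Sum>j<n. hat_mat X M $$ (i, j) * \<mu> $ j)" for M i
  define R where "R M = sqnorm (\<mu> - hat_mat X M *\<^sub>v \<mu>)" for M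
  \<comment> \<open>If the residual vanishes, division by zero makes \<open>v M\<close> zero; hence
    norms at most 1 instead of exactly 1.\<close>
  define v where "v M i = r M i / sqrt (R M)" for M i
  define V where "V = (\<Union>M\<in>Ms. insert (v M) (u M ` {..<card M}))"
  have R: "R M = (\<Sum>i<n. (r M i)\<^sup>2)" if "M \<in> Ms" for M
    unfolding R_def r_def
    by (rule residual_sqnorm[OF hat_mat_properties(1)[OF X Ms(1)[OF that] Ms(3)[OF that]] \<mu>])
  have R0: "0 \<le> R M" if "M \<in> Ms" for M unfolding R[OF that] by (intro sum_nonneg) auto
  show ?thesis
  proof (intro exI[of _ V] exI[of _ u] exI[of _ v] conjI ballI allI impI)
    show "finite V" using fin by (simp add: V_def)
    have "card V \<le> (\<Sum>M\<in>Ms. card (insert (v M) (u M ` {..<card M})))"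
      unfolding V_def by (rule card_UN_le[OF fin])
    also have "\<dots> \<le> (\<Sum>M\<in>Ms. k + 1)"
    proof (rule sum_mono)
      fix M assume "M \<in> Ms"
      then have "card (u M ` {..<card M}) \<le> k"
        using card_image_le[of "{..<card M}" "u M"] Ms(2)[of M] by simp
      then show "card (insert (v M) (u M ` {..<card M})) \<le> k + 1"
        using card_insert_le_m1[of "k + 1" "u M ` {..<card M}" "v M"] by simp
    qed
    finally show "card V \<le> card Ms * (k + 1)" by simp
    show "insert (v M) (u M ` {..<card M}) \<subseteq> V" if "M \<in> Ms" for M using that by (auto simp: V_def)
    show "(\<Sum>i<n. (z i)\<^sup>2) \<le> 1" if z: "z \<in> V" for z
    proof -
      obtain M where M: "M \<in> Ms" "z = v M \<or> (\<exists>j<card M. z = u M j)" using z by (auto simp: V_def)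
      show ?thesis
      proof (cases "z = v M")
        case True
        have "(\<Sum>i<n. (v M i)\<^sup>2) = R M / R M"
          using R0[OF M(1)] by (simp add: v_def power_divide sum_divide_distrib[symmetric] R[OF M(1), symmetric])
        then show ?thesis using True by simp
      qed (use M u[OF M(1)] in \<open>auto simp: Q_def\<close>)
    qed
    show "(\<Sum>a<n. \<Sum>b<n. x a * hat_mat X M $$ (a, b) * x b) = (\<Sum>j<card M. (\<Sum>a<n. u M j a * x a)\<^sup>2)"
      if "M \<in> Ms" for M x using u[OF that] by (simp add: Q_def)
    show "\<mu> $ i - (\<Sum>j<n. hat_mat X M $$ (i, j) * \<mu> $ j) = sqrt (sqnorm (\<mu> - hat_mat X M *\<^sub>v \<mu>)) * v M i"
      if M: "M \<in> Ms" and i: "i < n" for M i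
    proof (cases "R M = 0")
      case True
      then have "r M i = 0"
        using R[OF M] sum_nonneg_eq_0_iff[of "{..<n}" "\<lambda>i. (r M i)\<^sup>2"] i by simp
      then show ?thesis using True by (simp add: r_def R_def)
    next
      case False
      then show ?thesis unfolding R_def[symmetric] r_def[symmetric] v_def using R0[OF M] by simp
    qed
  qed
qed

text \<open>The estimate for one n and one \<alpha>. The constant involves only \<sigma>, \<delta>,
  \<open>B\<close> and \<open>C0\<close>, which is what makes it uniform over the sequence.\<close>

lemma ErrHat_variance_bound:
  fixes \<sigma> \<delta> \<alpha> B C0 :: real and P :: "'w measure" and k n :: nat and \<mu> :: "real vec"
  assumes \<sigma>: "\<sigma> > 0" and \<alpha>: "0 < \<alpha>" "\<alpha> < \<delta>" and n: "n \<ge> 1"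
    and X: "X \<in> carrier_mat n p" and \<mu>: "\<mu> \<in> carrier_vec n"
    and sub: "Ms \<subseteq> Pow {..<p}" and sel: "selection_map n Ms Mhat"
    and inv: "\<And>M. M \<in> Ms \<Longrightarrow> invertible_mat ((sel_cols X M)\<^sup>T * sel_cols X M)"
    and k: "\<And>M. M \<in> Ms \<Longrightarrow> card M \<le> k"
    and C0: "(1 + real k)\<^sup>2 * (1 + ln (real (card Ms * (k + 1))))\<^sup>2 \<le> C0 * real n"
    and B: "(\<integral>y. (sqnorm (\<mu> - hat_mat X (Mhat y) *\<^sub>v \<mu>))\<^sup>2
              \<partial>completion (gaussian n \<mu> (\<sigma>\<^sup>2 + \<alpha> * \<sigma>\<^sup>2))) \<le> B * real n"
    and P: "prob_space P" and y: "gaussian_rv P n \<mu> (\<sigma>\<^sup>2) y"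
    and \<omega>: "gaussian_rv P n (0\<^sub>v n) (\<alpha> * \<sigma>\<^sup>2) \<omega>"
    and ind: "prob_space.indep_var P (Rn n) y (Rn n) \<omega>"
  defines "Z \<equiv> \<lambda>w. ErrHat n X Mhat \<sigma> \<alpha> (y w) (\<omega> w) / real n"
  shows "integrable (completion P) Z" and "integrable (completion P) (\<lambda>w. (Z w)\<^sup>2)"
    and "prob_space.variance (completion P) Z \<le> variance_const \<sigma> \<delta> B C0 / (real n * \<alpha>\<^sup>2)"
proof -
  interpret prob_space P by (rule P)
  define t where "t = \<sigma>\<^sup>2 + \<alpha> * \<sigma>\<^sup>2"
  have pos: "\<sigma>\<^sup>2 > 0" "\<alpha> * \<sigma>\<^sup>2 > 0" "t > 0" using \<sigma> \<alpha> by (auto simp: t_def intro!: add_pos_pos)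
  define s where "s w = (\<lambda>i\<in>{..<n}. y w i + \<omega> w i)" for w
  have s: "gaussian_rv P n \<mu> t s"
    using gaussian_rv_add[OF P y \<omega> ind pos(1,2)] \<mu> by (simp add: s_def[abs_def] t_def)
  have meas: "y \<in> P \<rightarrow>\<^sub>M Rn n" "\<omega> \<in> P \<rightarrow>\<^sub>M Rn n" "s \<in> P \<rightarrow>\<^sub>M Rn n"
    using y \<omega> s by (auto simp: gaussian_rv_def)
  have fin: "finite Ms" using sub by (rule finite_subset) simp
  have sub': "M \<subseteq> {..<p}" if "M \<in> Ms" for M using sub that by auto
  note H = hat_mat_properties(1)[OF X sub' inv]
  obtain M' N where M': "M' \<in> Rn n \<rightarrow>\<^sub>M count_space Ms" and N: "N \<in> null_sets (Rn n)"
    and MN: "\<And>z. z \<in> space (Rn n) \<Longrightarrow> z \<notin> N \<Longrightarrow> M' z = Mhat z"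
    by (rule selection_map_measurable_version[OF sel fin]) blast
  have M'_Ms: "M' z \<in> Ms" if "z \<in> space (Rn n)" for z using measurable_space[OF M' that] by simp
  have Ms0: "Ms \<noteq> {}"
    using M'_Ms[of "\<lambda>i\<in>{..<n}. 0"] by (auto simp: space_Rn)
  define R where "R z = (sqnorm (\<mu> - hat_mat X (M' z) *\<^sub>v \<mu>))\<^sup>2" for z
  have R_meas: "R \<in> borel_measurable (Rn n)"
    unfolding R_def by (rule measurable_compose[OF M']) simp
  \<comment> \<open>\<open>R\<close> takes finitely many values on the space, hence is bounded.
    Integrability matters because the integral bound in \<open>B\<close> alone would also hold for
    the default value 0 of a non-integrable function.\<close>
  have R_int: "integrable (gaussian n \<mu> t) R"
  proof -
    interpret G: prob_space "gaussian n \<mu> t" using pos(3) by (rule prob_space_gaussian)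
    show ?thesis
    proof (rule G.integrable_const_bound)
      show "AE z in gaussian n \<mu> t. norm (R z) \<le> (\<Sum>M\<in>Ms. (sqnorm (\<mu> - hat_mat X M *\<^sub>v \<mu>))\<^sup>2)"
      proof (rule AE_I2)
        fix z assume "z \<in> space (gaussian n \<mu> t)"
        then have "M' z \<in> Ms" by (simp add: space_gaussian M'_Ms)
        then have "R z \<le> (\<Sum>M\<in>Ms. (sqnorm (\<mu> - hat_mat X M *\<^sub>v \<mu>))\<^sup>2)"
          unfolding R_def using fin by (intro member_le_sum) auto
        then show "norm (R z) \<le> (\<Sum>M\<in>Ms. (sqnorm (\<mu> - hat_mat X M *\<^sub>v \<mu>))\<^sup>2)" by (simp add: R_def)
      qed
    qed (use R_meas in simp)
  qed
  define IR where "IR = (\<integral>z. R z \<partial>gaussian n \<mu> t)"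
  have "AE z in gaussian n \<mu> t. (sqnorm (\<mu> - hat_mat X (Mhat z) *\<^sub>v \<mu>))\<^sup>2 = R z"
    using AE_not_in[OF null_sets_gaussian[OF pos(3) N]] AE_space[of "gaussian n \<mu> t"]
    by eventually_elim (use MN in \<open>simp add: R_def space_gaussian\<close>)
  then have IR: "IR \<le> B * real n"
    using B integral_completion_AE(1)[of R "gaussian n \<mu> t"] R_meas unfolding IR_def t_def by simp
  have models: "\<forall>M\<in>Ms. M \<subseteq> {..<p} \<and> card M \<le> k \<and> invertible_mat ((sel_cols X M)\<^sup>T * sel_cols X M)"
    using sub' k inv by blast
  obtain V u v where V: "finite V" "card V \<le> card Ms * (k + 1)" "\<forall>z\<in>V. (\<Sum>i<n. (z i)\<^sup>2) \<le> 1"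
    and uv: "\<forall>M\<in>Ms. insert (v M) (u M ` {..<card M}) \<subseteq> V
      \<and> (\<forall>x. (\<Sum>a<n. \<Sum>b<n. x a * hat_mat X M $$ (a, b) * x b)
          = (\<Sum>j<card M. (\<Sum>a<n. u M j a * x a)\<^sup>2))
      \<and> (\<forall>i<n. \<mu> $ i - (\<Sum>j<n. hat_mat X M $$ (i, j) * \<mu> $ j)
          = sqrt (sqnorm (\<mu> - hat_mat X M *\<^sub>v \<mu>)) * v M i)"
    using model_directions[OF X \<mu> fin models] by (elim exE conjE)
  have u: "(\<Sum>a<n. \<Sum>b<n. x a * hat_mat X M $$ (a, b) * x b)
      = (\<Sum>j<card M. (\<Sum>a<n. u M j a * x a)\<^sup>2)" if "M \<in> Ms" for M x
    using uv that by (elim ballE conjE allE) auto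
  have v: "\<mu> $ i - (\<Sum>j<n. hat_mat X M $$ (i, j) * \<mu> $ j)
      = sqrt (sqnorm (\<mu> - hat_mat X M *\<^sub>v \<mu>)) * v M i" if "M \<in> Ms" "i < n" for M i
    using uv that by simp
  define L where "L = real (card Ms * (k + 1))"
  have "card Ms * (k + 1) \<ge> 1" using Ms0 fin by (simp add: Suc_le_eq card_gt_0_iff)
  then have L: "L \<ge> 1" "real (card V) \<le> L" using V(2) unfolding L_def by linarith+
  obtain W1 where W1: "W1 \<in> borel_measurable (Rn n)"
    "\<forall>x. \<forall>z\<in>V. (\<Sum>i<n. z i * (x i - \<mu> $ i))^4 \<le> W1 x"
    "integrable (gaussian n \<mu> (\<sigma>\<^sup>2)) W1" "(\<integral>x. W1 x \<partial>gaussian n \<mu> (\<sigma>\<^sup>2)) \<le> 1056 * (\<sigma>\<^sup>2)\<^sup>2 * (1 + ln L)\<^sup>2"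
    using gaussian_linear_forms_fourth_moment[where m = \<mu>, OF pos(1) V(1,3) L] by (elim exE conjE)
  obtain W2 where W2: "W2 \<in> borel_measurable (Rn n)"
    "\<forall>x. \<forall>z\<in>V. (\<Sum>i<n. z i * (x i - 0\<^sub>v n $ i))^4 \<le> W2 x"
    "integrable (gaussian n (0\<^sub>v n) (\<alpha> * \<sigma>\<^sup>2)) W2"
    "(\<integral>x. W2 x \<partial>gaussian n (0\<^sub>v n) (\<alpha> * \<sigma>\<^sup>2)) \<le> 1056 * (\<alpha> * \<sigma>\<^sup>2)\<^sup>2 * (1 + ln L)\<^sup>2"
    using gaussian_linear_forms_fourth_moment[where m = "0\<^sub>v n", OF pos(2) V(1,3) L] by (elim exE conjE)
  define I1 where "I1 = (\<integral>x. W1 x \<partial>gaussian n \<mu> (\<sigma>\<^sup>2))"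
  define I2 where "I2 = (\<integral>x. W2 x \<partial>gaussian n (0\<^sub>v n) (\<alpha> * \<sigma>\<^sup>2))"
  define S where "S m \<tau> x = ((\<Sum>i<n. (x i - m $ i)\<^sup>2) - real n * \<tau>)\<^sup>2" for m :: "real vec" and \<tau> x
  have S_meas: "S m \<tau> \<in> borel_measurable (Rn n)" for m \<tau> unfolding S_def by measurable
  have S_int: "\<tau> > 0 \<Longrightarrow> has_bochner_integral (gaussian n m \<tau>) (S m \<tau>) (2 * real n * \<tau>\<^sup>2)" for m \<tau>
    unfolding S_def by (rule gaussian_centered_sqnorm)
  \<comment> \<open>An integrable majorant of the squared scaled deviation; each summand depends on
    only one of \<open>y\<close>, \<open>\<omega>\<close>, \<open>s\<close>, so the three marginal
    Gaussian laws determine its expectation.\<close>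
  define G where "G w = 9 * ((1 + \<delta>)\<^sup>2 * S \<mu> (\<sigma>\<^sup>2) (y w)
    + (1 + \<delta>)\<^sup>2 * (S (0\<^sub>v n) (\<alpha> * \<sigma>\<^sup>2) (\<omega> w) / \<alpha>\<^sup>2)
    + S \<mu> t (s w) + \<delta>\<^sup>2 * R (s w)
    + \<delta>\<^sup>2 * ((real k)\<^sup>2 * W1 (y w)) + 2 * \<delta>\<^sup>2 * (R (s w) + W1 (y w)) + 2 * (R (s w) + W2 (\<omega> w))
    + 2 * ((real k)\<^sup>2 * W1 (y w) + (real k)\<^sup>2 * W2 (\<omega> w)) + 4 * \<delta>\<^sup>2 * ((real k)\<^sup>2 * (\<sigma>\<^sup>2)\<^sup>2))" for w
  define IG where "IG = 9 * ((1 + \<delta>)\<^sup>2 * (2 * real n * (\<sigma>\<^sup>2)\<^sup>2)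
    + (1 + \<delta>)\<^sup>2 * (2 * real n * (\<alpha> * \<sigma>\<^sup>2)\<^sup>2 / \<alpha>\<^sup>2)
    + 2 * real n * t\<^sup>2 + \<delta>\<^sup>2 * IR
    + \<delta>\<^sup>2 * ((real k)\<^sup>2 * I1) + 2 * \<delta>\<^sup>2 * (IR + I1) + 2 * (IR + I2)
    + 2 * ((real k)\<^sup>2 * I1 + (real k)\<^sup>2 * I2) + 4 * \<delta>\<^sup>2 * ((real k)\<^sup>2 * (\<sigma>\<^sup>2)\<^sup>2))"
  have const: "has_bochner_integral P (\<lambda>_. c) c" for c :: real
    by (simp add: has_bochner_integral_iff prob_space)
  have G: "has_bochner_integral P G IG"
    unfolding G_def IG_def IR_def I1_def I2_def
    by (intro has_bochner_integral_mult_right has_bochner_integral_add has_bochner_integral_divide_zero const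
        gaussian_rv_has_bochner_integral[OF y] gaussian_rv_has_bochner_integral[OF \<omega>]
        gaussian_rv_has_bochner_integral[OF s] S_meas S_int pos R_meas W1(1) W2(1)
        has_bochner_integral_integrable R_int W1(3) W2(3))
  have IG: "IG \<le> variance_const \<sigma> \<delta> B C0 * real n"
    unfolding IG_def t_def
    by (rule expected_bound_le_variance_const[OF \<alpha> C0])
      (use L IR W1(4) W2(4) in \<open>auto simp: I1_def I2_def L_def\<close>)
  define E where "E w = ErrHat n X M' \<sigma> \<alpha> (y w) (\<omega> w)" for w
  define c where "c = real n * \<sigma>\<^sup>2"
  have E_meas: "E \<in> borel_measurable P"
    unfolding E_def by (rule borel_measurable_ErrHat[OF M' fin H meas(1,2)])
  have dev: "(\<alpha> * (E w - c))\<^sup>2 \<le> G w" if w: "w \<in> space P" for w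
  proof -
    have M: "M' (s w) \<in> Ms" using measurable_space[OF meas(3) w] by (rule M'_Ms)
    have sw: "(\<Sum>i<n. (y w i + \<omega> w i - \<mu> $ i)\<^sup>2) = (\<Sum>i<n. (s w i - \<mu> $ i)\<^sup>2)"
      by (intro sum.cong) (auto simp: s_def)
    have ow: "(\<Sum>i<n. (\<omega> w i)\<^sup>2) = (\<Sum>i<n. (\<omega> w i - 0\<^sub>v n $ i)\<^sup>2)" by (intro sum.cong) auto
    have zw: "(\<Sum>i<n. z i * \<omega> w i) = (\<Sum>i<n. z i * (\<omega> w i - 0\<^sub>v n $ i))" for z :: "nat \<Rightarrow> real"
      by (intro sum.cong) auto
    show ?thesis
      unfolding E_def c_def G_def S_def R_def t_def sw[symmetric] ow[symmetric]
    proof (rule ErrHat_deviation_bound[OF \<alpha> X sub'[OF M] inv[OF M] \<mu> k[OF M] _ u[OF M] v[OF M]])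
      show "M' (\<lambda>i\<in>{..<n}. y w i + \<omega> w i) = M' (s w)" by (simp add: s_def)
      fix z assume "z \<in> insert (v (M' (s w))) (u (M' (s w)) ` {..<card (M' (s w))})"
      then have z: "z \<in> V" using uv M by blast
      show "(\<Sum>i<n. z i * (y w i - \<mu> $ i))^4 \<le> W1 (y w)" using W1(2) z by blast
      show "(\<Sum>i<n. z i * \<omega> w i)^4 \<le> W2 (\<omega> w)" unfolding zw using W2(2) z by blast
    qed
  qed
  define Y where "Y w = E w / real n" for w
  have Y_meas: "Y \<in> borel_measurable P" unfolding Y_def using E_meas by measurable
  have D2: "integrable P (\<lambda>w. (\<alpha> * (E w - c))\<^sup>2)"
    by (rule Bochner_Integration.integrable_bound[of P G])
      (use G E_meas dev in \<open>auto simp: has_bochner_integral_iff intro!: order_trans[OF _ abs_ge_self]\<close>)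
  have E2: "(\<integral>w. (\<alpha> * (E w - c))\<^sup>2 \<partial>P) \<le> variance_const \<sigma> \<delta> B C0 * real n"
  proof -
    have "(\<integral>w. (\<alpha> * (E w - c))\<^sup>2 \<partial>P) \<le> (\<integral>w. G w \<partial>P)"
      using D2 G dev by (intro integral_mono) (auto simp: has_bochner_integral_iff)
    then show ?thesis using IG G by (simp add: has_bochner_integral_iff)
  qed
  have scale: "(Y w - c / real n)\<^sup>2 = (1 / (\<alpha> * real n)\<^sup>2) * (\<alpha> * (E w - c))\<^sup>2" for w
    using \<alpha> n by (simp add: Y_def diff_divide_distrib[symmetric] power_divide power_mult_distrib)
  have Yc2: "integrable P (\<lambda>w. (Y w - c / real n)\<^sup>2)"
    unfolding scale using D2 by (rule integrable_mult_right)
  \<comment> \<open>On a probability space square integrability implies integrability; undoing the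
    shift then gives both moments of \<open>Y\<close>.\<close>
  have Yc: "integrable P (\<lambda>w. Y w - c / real n)"
    by (rule square_integrable_imp_integrable[OF borel_measurable_diff[OF Y_meas borel_measurable_const] Yc2])
  have Y1: "integrable P Y"
    using Bochner_Integration.integrable_add[OF Yc integrable_const[of "c / real n"]] by simp
  have Y2: "integrable P (\<lambda>w. (Y w)\<^sup>2)"
  proof -
    have "integrable P (\<lambda>w. (Y w - c / real n)\<^sup>2 + 2 * (c / real n) * Y w - (c / real n)\<^sup>2)"
      using Yc2 Y1 by (intro Bochner_Integration.integrable_diff Bochner_Integration.integrable_add) auto
    moreover have "(Y w - c / real n)\<^sup>2 + 2 * (c / real n) * Y w - (c / real n)\<^sup>2 = (Y w)\<^sup>2" for w
      by (simp add: power2_diff)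
    ultimately show ?thesis by simp
  qed
  have "variance Y \<le> expectation (\<lambda>w. (Y w - c / real n)\<^sup>2)"
    by (rule variance_le_second_moment[OF Y1 Y2])
  also have "\<dots> = (1 / (\<alpha> * real n)\<^sup>2) * (\<integral>w. (\<alpha> * (E w - c))\<^sup>2 \<partial>P)"
    unfolding scale by simp
  also have "\<dots> \<le> (1 / (\<alpha> * real n)\<^sup>2) * (variance_const \<sigma> \<delta> B C0 * real n)"
    using E2 by (intro mult_left_mono) auto
  also have "\<dots> = variance_const \<sigma> \<delta> B C0 / (real n * \<alpha>\<^sup>2)"
    using n by (simp add: power2_eq_square field_simps)
  finally have var: "variance Y \<le> variance_const \<sigma> \<delta> B C0 / (real n * \<alpha>\<^sup>2)" .
  \<comment> \<open>Back to the original selection: \<open>s\<close> avoids the exceptional null set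
    almost surely, so completing \<open>P\<close> carries all three claims from \<open>Y\<close> to
    \<open>Z\<close>.\<close>
  have ae: "AE w in P. Z w = Y w"
    using gaussian_rv_AE[OF s pos(3) N] AE_space
  proof eventually_elim
    case (elim w)
    then have "M' (s w) = Mhat (s w)" using MN measurable_space[OF meas(3)] by blast
    then show ?case by (simp add: Z_def Y_def E_def ErrHat_def s_def)
  qed
  show "integrable (completion P) Z"
    using integral_completion_AE(2)[OF Y_meas ae] Y1 by simp
  have eqZ: "integral\<^sup>L (completion P) Z = expectation Y"
    by (rule integral_completion_AE(1)[OF Y_meas ae])
  have "AE w in P. (Z w)\<^sup>2 = (Y w)\<^sup>2" using ae by eventually_elim simp
  then show "integrable (completion P) (\<lambda>w. (Z w)\<^sup>2)"
    using integral_completion_AE(2)[of "\<lambda>w. (Y w)\<^sup>2" P] Y_meas Y2 by simp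
  interpret c: prob_space "completion P"
    by (rule prob_spaceI) (simp add: emeasure_space_1)
  have "AE w in P. (Z w - expectation Y)\<^sup>2 = (Y w - expectation Y)\<^sup>2" using ae by eventually_elim simp
  then have "c.variance Z = variance Y"
    unfolding eqZ
    by (rule integral_completion_AE(1)[OF borel_measurable_power[OF borel_measurable_diff[OF Y_meas borel_measurable_const]]])
  then show "c.variance Z \<le> variance_const \<sigma> \<delta> B C0 / (real n * \<alpha>\<^sup>2)" using var by simp
qed

section \<open>Counting models and making the constants uniform in n\<close>

lemma card_bounded_subsets_le:
  assumes "\<And>M. M \<in> Ms \<Longrightarrow> M \<subseteq> {..<p} \<and> card M \<le> k"
  shows "card Ms \<le> (p + 1) ^ k"
proof -
  \<comment> \<open>The extra letter \<open>p\<close> pads the list of a smaller model to length k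
    and is removed by intersecting with \<open>{..<p}\<close>; hence p + 1 letters.\<close>
  let ?L = "{xs. set xs \<subseteq> {..p} \<and> length xs = k}"
  have "Ms \<subseteq> (\<lambda>xs. set xs \<inter> {..<p}) ` ?L"
  proof
    fix M assume M: "M \<in> Ms"
    then have "finite M" using assms finite_subset[of M "{..<p}"] by auto
    then obtain ys where ys: "set ys = M" "length ys = card M"
      using finite_distinct_list distinct_card by metis
    have "M \<subseteq> {..<p}" using assms M by blast
    then have "ys @ replicate (k - card M) p \<in> ?L" "M = set (ys @ replicate (k - card M) p) \<inter> {..<p}"
      using ys assms[OF M] by (auto simp: set_replicate_conv_if)
    then show "M \<in> (\<lambda>xs. set xs \<inter> {..<p}) ` ?L" by blast
  qed
  then have "card Ms \<le> card ?L"
    by (rule surj_card_le[rotated]) (simp add: finite_lists_length_eq)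
  then show ?thesis by (simp add: card_lists_length_eq)
qed

lemma bigo_sqrt_bound:
  fixes f :: "nat \<Rightarrow> real"
  assumes "f \<in> O(\<lambda>n. sqrt (real n))"
  shows "\<exists>c\<ge>0. \<forall>n\<ge>1. f n \<le> c * sqrt (real n)"
proof -
  obtain c where c: "c > 0" "eventually (\<lambda>n. norm (f n) \<le> c * norm (sqrt (real n))) at_top"
    using landau_o.bigE[OF assms] by blast
  then obtain N where N: "\<And>n. n \<ge> N \<Longrightarrow> \<bar>f n\<bar> \<le> c * sqrt (real n)"
    by (auto simp: eventually_at_top_linorder)
  \<comment> \<open>Absorbs the finitely many indices before the asymptotic bound sets in, using
    sqrt n \<ge> 1.\<close>
  define d where "d = (\<Sum>n<N. \<bar>f n\<bar>)"
  have d: "d \<ge> 0" unfolding d_def by (intro sum_nonneg) auto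
  have "f n \<le> (c + d) * sqrt (real n)" if n: "n \<ge> 1" for n
  proof (cases "n < N")
    case True
    have "\<bar>f n\<bar> \<le> d" unfolding d_def using True by (intro member_le_sum) auto
    also have "\<dots> \<le> (c + d) * 1" using c by simp
    also have "\<dots> \<le> (c + d) * sqrt (real n)" using n c d by (intro mult_left_mono) auto
    finally show ?thesis by simp
  next
    case False
    then have "f n \<le> c * sqrt (real n)" using N[of n] by simp
    also have "\<dots> \<le> (c + d) * sqrt (real n)" using d by (intro mult_right_mono) auto
    finally show ?thesis .
  qed
  then show ?thesis using c d by (intro exI[of _ "c + d"]) auto
qed

lemma log_model_count_bound:
  fixes p K k :: nat
  assumes Ms: "\<And>M. M \<in> Ms \<Longrightarrow> M \<subseteq> {..<p} \<and> card M \<le> K" and ne: "Ms \<noteq> {}"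
  defines "k \<equiv> min K p"
  shows "(1 + real k) * (1 + ln (real (card Ms * (k + 1)))) \<le> 12 * ((real K)\<^sup>2 * ln (real p)) + 8"
proof -
  have Msk: "M \<subseteq> {..<p} \<and> card M \<le> k" if "M \<in> Ms" for M
    using Ms[OF that] card_mono[of "{..<p}" M] by (auto simp: k_def)
  have cMs: "card Ms \<le> (p + 1) ^ k" by (rule card_bounded_subsets_le) (rule Msk)
  have "finite Ms"
    using Ms by (intro finite_subset[of Ms "Pow {..<p}"]) auto
  then have "card Ms \<ge> 1" using ne by (simp add: Suc_le_eq card_gt_0_iff)
  have "ln (real (card Ms * (k + 1))) = ln (real (card Ms)) + ln (real (k + 1))"
    unfolding of_nat_mult using \<open>card Ms \<ge> 1\<close> by (subst ln_mult) auto
  also have "ln (real (card Ms)) \<le> ln (real ((p + 1) ^ k))"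
    using cMs \<open>card Ms \<ge> 1\<close> by (subst ln_le_cancel_iff) (auto simp del: of_nat_power)
  also have "ln (real ((p + 1) ^ k)) = real k * ln (real (p + 1))"
    by (simp add: ln_realpow)
  also have "ln (real (k + 1)) \<le> real k" using ln_le_minus_one[of "real (k + 1)"] by simp
  finally have l: "ln (real (card Ms * (k + 1))) \<le> real k * ln (real (p + 1)) + real k" by simp
  \<comment> \<open>For p = 0 this relies on the convention ln 0 = 0.\<close>
  have Kp: "0 \<le> (real K)\<^sup>2 * ln (real p)" by (cases "p = 0") auto
  consider "k = 0" | "p \<le> 1" "k \<ge> 1" | "p \<ge> 2" "k \<ge> 1" by linarith
  then show ?thesis
  proof cases
    case 1
    then show ?thesis using l Kp by simp
  next
    case 2
    \<comment> \<open>Here ln p = 0, so the additive 8 must suffice; the left side is at most 2 * (1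
      + 2) = 6.\<close>
    then have "k = 1" "p = 1" by (auto simp: k_def)
    moreover have "ln (2::real) \<le> 1" using ln_le_minus_one[of "2::real"] by simp
    ultimately show ?thesis using l by simp
  next
    case 3
    have "ln (real (p + 1)) \<le> ln ((real p)\<^sup>2)"
    proof (subst ln_le_cancel_iff)
      have "2 * real p \<le> real p * real p" using 3 by (intro mult_right_mono) auto
      then show "real (p + 1) \<le> (real p)\<^sup>2"
        using 3 unfolding power2_eq_square of_nat_add by linarith
    qed (use 3 in auto)
    then have lp: "ln (real (p + 1)) \<le> 2 * ln (real p)" using 3 by (simp add: ln_realpow)
    have "1 - 1 / 2 \<le> ln (2::real)" using ln_ge_iff[of "2::real"] ln_one_minus_pos_lower_bound[of "1/2"]
      ln_le_minus_one[of "1/2::real"] by (simp add: ln_div)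
    also have "\<dots> \<le> ln (real p)" using 3 by (subst ln_le_cancel_iff) auto
    finally have half: "1 \<le> 2 * ln (real p)" by simp
    have k1: "1 \<le> real k" using 3 by simp
    have "real k * ln (real (p + 1)) \<le> real k * (2 * ln (real p))" using lp by (intro mult_left_mono) auto
    moreover have "real k * 1 \<le> real k * (2 * ln (real p))" using half by (intro mult_left_mono) auto
    \<comment> \<open>Each of 1, k and k ln (p + 1) is at most 2 k ln p, giving 6; the estimate 1 +
      k \<le> 2 k then doubles it to 12.\<close>
    ultimately have "1 + ln (real (card Ms * (k + 1))) \<le> 6 * (real k * ln (real p))" using l k1 by linarith
    then have "(1 + real k) * (1 + ln (real (card Ms * (k + 1)))) \<le> (1 + real k) * (6 * (real k * ln (real p)))"
      by (intro mult_left_mono) auto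
    also have "\<dots> \<le> (2 * real k) * (6 * (real k * ln (real p)))"
      using k1 half by (intro mult_right_mono) auto
    also have "\<dots> = 12 * ((real k)\<^sup>2 * ln (real p))" by (simp add: power2_eq_square)
    also have "\<dots> \<le> 12 * ((real K)\<^sup>2 * ln (real p))"
      using half by (intro mult_left_mono mult_right_mono power_mono) (auto simp: k_def)
    finally show ?thesis by simp
  qed
qed

theorem theorem3p10:
  fixes \<sigma> \<delta> :: real
    and p K :: "nat \<Rightarrow> nat"
    and X :: "nat \<Rightarrow> real mat"
    and \<mu> :: "nat \<Rightarrow> real vec"
    and Ms :: "nat \<Rightarrow> nat set set"
    and Mhat :: "nat \<Rightarrow> (nat \<Rightarrow> real) \<Rightarrow> nat set"
  assumes "\<sigma> > 0" and "\<delta> > 0"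
    and "\<And>n. n \<ge> 1 \<Longrightarrow> X n \<in> carrier_mat n (p n)"
    and "\<And>n. n \<ge> 1 \<Longrightarrow> \<mu> n \<in> carrier_vec n"
    and "\<And>n. n \<ge> 1 \<Longrightarrow> Ms n \<subseteq> Pow {..<p n}"
    and "\<And>n. n \<ge> 1 \<Longrightarrow> selection_map n (Ms n) (Mhat n)"
    and "\<And>n M. n \<ge> 1 \<Longrightarrow> M \<in> Ms n \<Longrightarrow>
           invertible_mat ((sel_cols (X n) M)\<^sup>T * sel_cols (X n) M)"
    and "\<And>n M. n \<ge> 1 \<Longrightarrow> M \<in> Ms n \<Longrightarrow>
           vec_space.rank n (hat_mat (X n) M) \<le> card M \<and> card M \<le> K n"
    and "(\<lambda>n. (real (K n))\<^sup>2 * ln (real (p n))) \<in> O(\<lambda>n. sqrt (real n))"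
    and "\<exists>B. \<forall>n\<ge>1. \<forall>\<tau>\<in>{\<sigma>\<^sup>2..(1 + \<delta>) * \<sigma>\<^sup>2}.
           (\<integral>y. (sqnorm (\<mu> n - hat_mat (X n) (Mhat n y) *\<^sub>v \<mu> n))\<^sup>2
              \<partial>completion (gaussian n (\<mu> n) \<tau>)) \<le> B * real n"
  shows "\<exists>C. \<forall>n\<ge>1. \<forall>\<alpha>. 0 < \<alpha> \<and> \<alpha> < \<delta> \<longrightarrow>
           (\<forall>(P :: 'w measure) y \<omega>.
              prob_space P \<and>
              gaussian_rv P n (\<mu> n) (\<sigma>\<^sup>2) y \<and>
              gaussian_rv P n (0\<^sub>v n) (\<alpha> * \<sigma>\<^sup>2) \<omega> \<and>
              prob_space.indep_var P (Rn n) y (Rn n) \<omega> \<longrightarrow>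
              (let Z = (\<lambda>w. ErrHat n (X n) (Mhat n) \<sigma> \<alpha> (y w) (\<omega> w) / real n) in
                 integrable (completion P) Z \<and>
                 integrable (completion P) (\<lambda>w. (Z w)\<^sup>2) \<and>
                 prob_space.variance (completion P) Z \<le> C / (real n * \<alpha>\<^sup>2)))"
proof -
  obtain c where c: "c \<ge> 0" "\<And>n. n \<ge> 1 \<Longrightarrow> (real (K n))\<^sup>2 * ln (real (p n)) \<le> c * sqrt (real n)"
    using bigo_sqrt_bound[OF assms(9)] by blast
  obtain B where B: "\<And>n \<tau>. n \<ge> 1 \<Longrightarrow> \<tau> \<in> {\<sigma>\<^sup>2..(1 + \<delta>) * \<sigma>\<^sup>2} \<Longrightarrow>
      (\<integral>y. (sqnorm (\<mu> n - hat_mat (X n) (Mhat n y) *\<^sub>v \<mu> n))\<^sup>2 \<partial>completion (gaussian n (\<mu> n) \<tau>)) \<le> B * real n"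
    using assms(10) by blast
  define k where "k n = min (K n) (p n)" for n
  \<comment> \<open>The additive 8 is absorbed by sqrt n \<ge> 1, and squaring turns (12 c + 8) sqrt
    n into \<open>C0\<close> n.\<close>
  define C0 where "C0 = (12 * c + 8)\<^sup>2"
  have models: "M \<subseteq> {..<p n} \<and> card M \<le> K n" if "n \<ge> 1" "M \<in> Ms n" for n M
    using assms(5,8)[OF that(1)] that(2) by auto
  have card_k: "card M \<le> k n" if "n \<ge> 1" "M \<in> Ms n" for n M
    using models[OF that] card_mono[of "{..<p n}" M] by (auto simp: k_def)
  have C0: "(1 + real (k n))\<^sup>2 * (1 + ln (real (card (Ms n) * (k n + 1))))\<^sup>2 \<le> C0 * real n"
    if n: "n \<ge> 1" for n
  proof -
    have "(\<lambda>i\<in>{..<n}. 0) \<in> space (Rn n)" by (simp add: space_Rn)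
    then have ne: "Ms n \<noteq> {}" using assms(6)[OF n] unfolding selection_map_def by blast
    have "finite (Ms n)" using assms(5)[OF n] by (rule finite_subset) simp
    then have "1 \<le> card (Ms n) * (k n + 1)" using ne by (simp add: Suc_le_eq card_gt_0_iff)
    then have "0 \<le> ln (real (card (Ms n) * (k n + 1)))" by (intro ln_ge_zero) linarith
    moreover have "(1 + real (k n)) * (1 + ln (real (card (Ms n) * (k n + 1)))) \<le> (12 * c + 8) * sqrt (real n)"
    proof -
      have "(1 + real (k n)) * (1 + ln (real (card (Ms n) * (k n + 1)))) \<le> 12 * ((real (K n))\<^sup>2 * ln (real (p n))) + 8"
        unfolding k_def using models[OF n] ne by (rule log_model_count_bound)
      also have "\<dots> \<le> 12 * (c * sqrt (real n)) + 8 * sqrt (real n)"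
        using c(2)[OF n] n by (intro add_mono) auto
      finally show ?thesis by (simp add: algebra_simps)
    qed
    ultimately have "((1 + real (k n)) * (1 + ln (real (card (Ms n) * (k n + 1)))))\<^sup>2 \<le> ((12 * c + 8) * sqrt (real n))\<^sup>2"
      by (intro power_mono mult_nonneg_nonneg) auto
    then show ?thesis by (simp add: power_mult_distrib C0_def)
  qed
  show ?thesis
  proof (intro exI[of _ "variance_const \<sigma> \<delta> B C0"] allI impI)
    fix n :: nat and \<alpha> :: real and P :: "'w measure" and y \<omega>
    assume n: "1 \<le> n" and \<alpha>: "0 < \<alpha> \<and> \<alpha> < \<delta>"
      and P: "prob_space P \<and> gaussian_rv P n (\<mu> n) (\<sigma>\<^sup>2) y \<and>
        gaussian_rv P n (0\<^sub>v n) (\<alpha> * \<sigma>\<^sup>2) \<omega> \<and> prob_space.indep_var P (Rn n) y (Rn n) \<omega>"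
    \<comment> \<open>The place where \<alpha> < \<delta> brings the law of y + \<omega> into the
      range of the accuracy condition.\<close>
    have "\<sigma>\<^sup>2 + \<alpha> * \<sigma>\<^sup>2 \<in> {\<sigma>\<^sup>2..(1 + \<delta>) * \<sigma>\<^sup>2}"
      using \<alpha> by (auto simp: distrib_right intro!: mult_right_mono)
    note bound = ErrHat_variance_bound[where P = P and y = y and \<omega> = \<omega>, OF assms(1) conjunct1[OF \<alpha>] conjunct2[OF \<alpha>] n
      assms(3-6)[OF n] assms(7)[OF n] card_k[OF n] C0[OF n] B[OF n this]]
    show "let Z = \<lambda>w. ErrHat n (X n) (Mhat n) \<sigma> \<alpha> (y w) (\<omega> w) / real n
      in integrable (completion P) Z \<and> integrable (completion P) (\<lambda>w. (Z w)\<^sup>2) \<and>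
        prob_space.variance (completion P) Z \<le> variance_const \<sigma> \<delta> B C0 / (real n * \<alpha>\<^sup>2)"
      unfolding Let_def using bound P by blast
  qed
qed

end
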